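(* For a group-theoretical category of partitions $\mathcal C$ let $F(\mathcal C)\subseteq \mathbb Z_2^{*\infty}$ be the set of all elements $w(p,l)$, where $p\in\mathcal C$ and $l$ is a labelling of $p$. For an $sS_\infty$-invariant normal subgroup $H$ of $\mathbb Z_2^{*\infty}$ let $\mathcal C_H:=\{p\in P \mid \text{there is a labelling } l \text{ of } p \text{ such that } w(p,l)\in H\}$. Then the maps $\mathcal C\mapsto F(\mathcal C)$ and $H\mapsto\mathcal C_H$ are inverse to each other. Hence $F$ is a bijective lattice homomorphism from the group-theoretical categories of partitions onto the $sS_\infty$-invariant normal subgroups of $\mathbb Z_2^{*\infty}$.
   Context: **Partitions.** For $k,l\in\mathbb N_0$, $P(k,l)$ is the set of all set partitions of a set of $k$ upper points and $l$ lower points, each row ordered from left to right; the subsets are called blocks. $P$ is the collection of all $P(k,l)$. $P(0,0)$ contains only the empty partition $\emptyset$. **Category operations.** Tensor product: for $p\in P(k,l)$, $q\in P(k',l')$, $p\otimes q\in P(k+k',l+l')$ is obtained by writing $p$ and $q$ next to each other ($p$ on the left). Composition: for $p\in P(k,l)$, $q\in P(l,m)$, $qp\in P(k,m)$ is obtained by identifying the lower points of $p$ with the upper points of $q$, joining the blocks accordingly, and then removing the $l$ middle points (and everything not connected to the remaining $k+m$ points). Involution: $p^*\in P(l,k)$ is $p\in P(k,l)$ turned upside down. Rotation: moving the leftmost upper point to the left end of the lower row, or the leftmost lower point to the left end of the upper row, and likewise at the right-hand side; moved points remain in their blocks. A category of partitions is a collection $\mathcal C$ of subsets $\mathcal C(k,l)\subseteq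 P(k,l)$, $k,l\in\mathbb N_0$, closed under these operations and containing the identity partition $|\in P(1,1)$ (one upper point connected to one lower point); then it also contains the pair partition $\sqcap\in P(0,2)$ (two connected lower points). **Group-theoretical.** The pair positioner partition is the element of $P(3,3)$ with upper points $1,2,3$, lower points $1',2',3'$ and blocks $\{1,2,2',3'\}$ and $\{3,1'\}$. A category of partitions is group-theoretical if it contains the pair positioner partition. **Labellings and words.** $\mathbb Z_2^{*\infty}$ is the free product of countably infinitely many copies of the cyclic group of order two, with generators $a_1,a_2,\dots$ ($a_i^2=e$). A labelling $l=(a_{i(1)},\dots,a_{i(k+m)})$ of $p\in P(k,m)$ assigns a generator to each point, starting at the lower left point and going around counterclockwise (the lower points from left to right, then the upper points from right to left), such that points of the same block get the same letter and different blocks get different letters. Then $w(p,l):=a_{i(1)}a_{i(2)}\cdots a_{i(k+m)}\in\mathbb Z_2^{*\infty}$. **The semigroup $sS_\infty$.** $sS_\infty$ is the subsemigroup of $\operatorname{End}(\mathbb Z_2^{*\infty})$ generated by all endomorphisms of the form $a_k\mapsto a_{i(k)}$ for $1\le k\le n$ and $a_k\mapsto a_k$ for $k>n$, where $n\in\mathbb N$ and $i(1),\dots,i(n)$ are arbitrary indices. A subgroup $H$ is $sS_\infty$-invariant if $\phi(H)\subseteq H$ for all $\phi\in sS_\infty$. **Lattices.** Both the group-theoretical categories of partitions and the $sS_\infty$-invariant normal subgroups are lattices ordered by inclusion (meet: intersection; join: the smallest such object containing both). *)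

theory Defs
  imports "HOL-Library.Disjoint_Sets" "HOL-Algebra.Coset" "HOL-Algebra.Lattice"
begin

section \<open>Partitions\<close>

text \<open>Each row is numbered from left to right, starting with 0. A partition in
  \<open>partitions k l\<close> has upper points \<open>Up i\<close> (\<open>i < k\<close>) and lower points \<open>Low j\<close> (\<open>j < l\<close>).
  The points \<open>Mid j\<close> only serve as the middle row in the definition of composition.\<close>

datatype point = Up nat | Mid nat | Low nat

type_synonym part = "point set set"

type_synonym part_family = "nat \<Rightarrow> nat \<Rightarrow> part set"

definition points :: "nat \<Rightarrow> nat \<Rightarrow> point set" where
  "points k l = Up ` {..<k} \<union> Low ` {..<l}"

definition partitions :: part_family where
  "partitions k l = {p. partition_on (points k l) p}"

definition relabel :: "(point \<Rightarrow> point) \<Rightarrow> part \<Rightarrow> part" where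
  "relabel f p = (\<lambda>B. f ` B) ` p"

section \<open>The category operations\<close>

primrec shift :: "nat \<Rightarrow> nat \<Rightarrow> point \<Rightarrow> point" where
  "shift k l (Up i) = Up (k + i)"
| "shift k l (Mid i) = Mid i"
| "shift k l (Low i) = Low (l + i)"

text \<open>\<open>tensor k l p q\<close> is the tensor product of \<open>p \<in> partitions k l\<close> with \<open>q\<close>.\<close>

definition tensor :: "nat \<Rightarrow> nat \<Rightarrow> part \<Rightarrow> part \<Rightarrow> part" where
  "tensor k l p q = p \<union> relabel (shift k l) q"

primrec low_to_mid :: "point \<Rightarrow> point" where
  "low_to_mid (Up i) = Up i"
| "low_to_mid (Mid i) = Mid i"
| "low_to_mid (Low i) = Mid i"

primrec up_to_mid :: "point \<Rightarrow> point" where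
  "up_to_mid (Up i) = Mid i"
| "up_to_mid (Mid i) = Mid i"
| "up_to_mid (Low i) = Low i"

text \<open>\<open>glue p q\<close> is the three-row diagram in which the lower points of \<open>p\<close> are identified
  with the upper points of \<open>q\<close>; its blocks may still overlap. In \<open>composition q p\<close> the
  overlapping blocks are merged (classes of the transitive closure of ``in a common block''),
  the middle points are removed, and blocks that have become empty are discarded.\<close>

definition glue :: "part \<Rightarrow> part \<Rightarrow> part" where
  "glue p q = relabel low_to_mid p \<union> relabel up_to_mid q"

definition connected_in :: "part \<Rightarrow> (point \<times> point) set" where
  "connected_in bs = (\<Union>B\<in>bs. B \<times> B)\<^sup>+"

definition composition :: "part \<Rightarrow> part \<Rightarrow> part" where
  "composition q p =
     (\<lambda>B. B - range Mid) ` (\<Union>(glue p q) // connected_in (glue p q)) - {{}}"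

primrec flip :: "point \<Rightarrow> point" where
  "flip (Up i) = Low i"
| "flip (Mid i) = Mid i"
| "flip (Low i) = Up i"

definition involution :: "part \<Rightarrow> part" where
  "involution p = relabel flip p"

text \<open>Rotations on the left: the leftmost point of one row becomes the leftmost
  point of the other row.\<close>

primrec rot_left_down :: "point \<Rightarrow> point" where
  "rot_left_down (Up i) = (case i of 0 \<Rightarrow> Low 0 | Suc i' \<Rightarrow> Up i')"
| "rot_left_down (Mid i) = Mid i"
| "rot_left_down (Low i) = Low (Suc i)"

primrec rot_left_up :: "point \<Rightarrow> point" where
  "rot_left_up (Up i) = Up (Suc i)"
| "rot_left_up (Mid i) = Mid i"
| "rot_left_up (Low i) = (case i of 0 \<Rightarrow> Up 0 | Suc i' \<Rightarrow> Low i')"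

text \<open>Rotations on the right: \<open>k\<close> and \<open>l\<close> are the lengths of the upper and the lower row
  without the point that is moved.\<close>

definition rot_right_down :: "nat \<Rightarrow> nat \<Rightarrow> point \<Rightarrow> point" where
  "rot_right_down k l x = (if x = Up k then Low l else x)"

definition rot_right_up :: "nat \<Rightarrow> nat \<Rightarrow> point \<Rightarrow> point" where
  "rot_right_up k l x = (if x = Low l then Up k else x)"

definition id_part :: part where
  "id_part = {{Up 0, Low 0}}"

definition pair_positioner :: part where
  "pair_positioner = {{Up 0, Up 1, Low 1, Low 2}, {Up 2, Low 0}}"

locale category_of_partitions =
  fixes C :: part_family
  assumes subset_partitions: "C k l \<subseteq> partitions k l"
    and tensor: "\<lbrakk>p \<in> C k l; q \<in> C k' l'\<rbrakk> \<Longrightarrow> tensor k l p q \<in> C (k + k') (l + l')"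
    and composition: "\<lbrakk>p \<in> C k l; q \<in> C l m\<rbrakk> \<Longrightarrow> composition q p \<in> C k m"
    and involution: "p \<in> C k l \<Longrightarrow> involution p \<in> C l k"
    and rot_left_down: "p \<in> C (Suc k) l \<Longrightarrow> relabel rot_left_down p \<in> C k (Suc l)"
    and rot_left_up: "p \<in> C k (Suc l) \<Longrightarrow> relabel rot_left_up p \<in> C (Suc k) l"
    and rot_right_down:
      "p \<in> C (Suc k) l \<Longrightarrow> relabel (rot_right_down k l) p \<in> C k (Suc l)"
    and rot_right_up:
      "p \<in> C k (Suc l) \<Longrightarrow> relabel (rot_right_up k l) p \<in> C (Suc k) l"
    and id_part: "id_part \<in> C 1 1"

locale group_theoretical = category_of_partitions +
  assumes pair_positioner: "pair_positioner \<in> C 3 3"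

section \<open>The free product of countably many copies of the cyclic group of order two\<close>

text \<open>The group is presented by generators \<open>gen i\<close> (\<open>i = 0, 1, 2, \<dots>\<close>) and relations
  \<open>(gen i)\<^sup>2 = 1\<close>: words in the letters \<open>i\<close>, modulo insertion and deletion of squares.
  Inverses need not be adjoined because every generator is its own inverse.\<close>

inductive weq :: "nat list \<Rightarrow> nat list \<Rightarrow> bool" where
  weq_cancel: "weq (xs @ [i, i] @ ys) (xs @ ys)"
| weq_refl: "weq xs xs"
| weq_sym: "weq xs ys \<Longrightarrow> weq ys xs"
| weq_trans: "weq xs ys \<Longrightarrow> weq ys zs \<Longrightarrow> weq xs zs"

lemma weq_context: "weq xs ys \<Longrightarrow> weq (us @ xs @ vs) (us @ ys @ vs)"
proof (induction rule: weq.induct)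
  case (weq_cancel xs i ys)
  then show ?case using weq.weq_cancel[of "us @ xs" i "ys @ vs"] by simp
qed (auto intro: weq.intros)

lemma weq_append: "weq xs ys \<Longrightarrow> weq us vs \<Longrightarrow> weq (xs @ us) (ys @ vs)"
  using weq_context[of xs ys "[]" us] weq_context[of us vs ys "[]"]
  by (auto intro: weq_trans)

lemma weq_rev_append: "weq (rev xs @ xs) []"
proof (induction xs)
  case (Cons x xs)
  have "weq (rev xs @ [x, x] @ xs) (rev xs @ xs)" by (rule weq_cancel)
  with Cons show ?case by (auto intro: weq_trans)
qed (simp add: weq_refl)

quotient_type z2word = "nat list" / weq
  by (rule equivpI) (auto simp: reflp_def symp_def transp_def intro: weq.intros)

lift_definition z2_mult :: "z2word \<Rightarrow> z2word \<Rightarrow> z2word" is "(@)"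
  by (rule weq_append)

lift_definition z2_one :: z2word is "[]" .

lift_definition gen :: "nat \<Rightarrow> z2word" is "\<lambda>i. [i]" .

definition Z2inf :: "z2word monoid" where
  "Z2inf = \<lparr>carrier = UNIV, mult = z2_mult, one = z2_one\<rparr>"

lemma Z2inf_simps [simp]:
  "carrier Z2inf = UNIV" "mult Z2inf = z2_mult" "one Z2inf = z2_one"
  by (simp_all add: Z2inf_def)

lemma group_Z2inf: "group Z2inf"
proof (rule groupI)
  fix x y z
  show "x \<otimes>\<^bsub>Z2inf\<^esub> y \<otimes>\<^bsub>Z2inf\<^esub> z = x \<otimes>\<^bsub>Z2inf\<^esub> (y \<otimes>\<^bsub>Z2inf\<^esub> z)"
    by simp (transfer, simp add: weq_refl)
  show "\<one>\<^bsub>Z2inf\<^esub> \<otimes>\<^bsub>Z2inf\<^esub> x = x"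
    by simp (transfer, simp add: weq_refl)
  have "\<exists>y. z2_mult y x = z2_one"
    by transfer (use weq_rev_append in blast)
  then show "\<exists>y\<in>carrier Z2inf. y \<otimes>\<^bsub>Z2inf\<^esub> x = \<one>\<^bsub>Z2inf\<^esub>"
    by simp
qed simp_all

text \<open>\<open>Z2inf\<close> has the universal property of the free product.\<close>

lemma Z2inf_universal:
  assumes "group G" and f: "\<And>i. f i \<in> carrier G" "\<And>i. f i \<otimes>\<^bsub>G\<^esub> f i = \<one>\<^bsub>G\<^esub>"
  shows "\<exists>!h. h \<in> hom Z2inf G \<and> (\<forall>i. h (gen i) = f i)"
proof -
  interpret group G by fact
  define ev where "ev = (\<lambda>xs. foldr (\<lambda>i x. f i \<otimes>\<^bsub>G\<^esub> x) xs \<one>\<^bsub>G\<^esub>)"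
  have [simp]: "f i \<in> carrier G" for i by (rule f(1))
  have ev_simps [simp]: "ev [] = \<one>\<^bsub>G\<^esub>" "ev (i # xs) = f i \<otimes>\<^bsub>G\<^esub> ev xs" for i xs
    by (simp_all add: ev_def)
  have ev_closed [simp]: "ev xs \<in> carrier G" for xs
    by (induction xs) auto
  have ev_append: "ev (xs @ ys) = ev xs \<otimes>\<^bsub>G\<^esub> ev ys" for xs ys
    by (induction xs) (auto simp: m_assoc)
  have cancel: "f i \<otimes>\<^bsub>G\<^esub> (f i \<otimes>\<^bsub>G\<^esub> x) = x" if "x \<in> carrier G" for i x
    using that by (simp add: m_assoc[symmetric] f(2))
  have "weq xs ys \<Longrightarrow> ev xs = ev ys" for xs ys
    by (induction rule: weq.induct) (simp_all add: ev_append cancel)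
  then have ev_rep: "ev (rep_z2word (abs_z2word xs)) = ev xs" for xs
    by (metis Quotient3_rep_abs Quotient3_z2word weq_refl)
  define h where "h = (\<lambda>x. ev (rep_z2word x))"
  have h_abs: "h (abs_z2word xs) = ev xs" for xs
    by (simp add: h_def ev_rep)
  have "h (z2_mult x y) = h x \<otimes>\<^bsub>G\<^esub> h y" for x y
    by (induction x rule: z2word.abs_induct, induction y rule: z2word.abs_induct)
      (simp add: z2_mult.abs_eq weq_refl h_abs ev_append)
  then have hom: "h \<in> hom Z2inf G"
    by (auto simp: hom_def h_def)
  have gen: "h (gen i) = f i" for i
    by (simp add: gen.abs_eq h_abs)
  have uniq: "h' = h" if h': "h' \<in> hom Z2inf G" "\<forall>i. h' (gen i) = f i" for h'
  proof
    fix x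
    have "h' (abs_z2word xs) = ev xs" for xs
    proof (induction xs)
      case Nil
      have "h' \<one>\<^bsub>Z2inf\<^esub> = \<one>\<^bsub>G\<^esub>" by (rule hom_one[OF h'(1) group_Z2inf assms(1)])
      then show ?case by (simp add: z2_one.abs_eq)
    next
      case (Cons i xs)
      have "abs_z2word (i # xs) = gen i \<otimes>\<^bsub>Z2inf\<^esub> abs_z2word xs"
        by (simp add: gen.abs_eq z2_mult.abs_eq weq_refl)
      then show ?case using Cons h' by (simp add: hom_mult[OF h'(1)] del: Z2inf_simps(2))
    qed
    then show "h' x = h x"
      by (induction x rule: z2word.abs_induct) (simp add: h_abs)
  qed
  show ?thesis using hom gen uniq by blast
qed

text \<open>In particular the generators are pairwise distinct, so that labelling points by
  indices is the same as labelling them by generators.\<close>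

lemma inj_gen: "inj gen"
proof (rule injI)
  fix i j assume "gen i = gen j"
  have inv: "weq xs ys \<Longrightarrow> even (count_list xs i) = even (count_list ys i)" for xs ys
    by (induction rule: weq.induct) auto
  from \<open>gen i = gen j\<close> have "weq [i] [j]" by transfer
  from inv[OF this] show "i = j" by (auto split: if_splits)
qed

section \<open>Labellings and words\<close>

text \<open>The points of a partition in \<open>partitions k m\<close> in counterclockwise order.\<close>

definition boundary :: "nat \<Rightarrow> nat \<Rightarrow> point list" where
  "boundary k m = map Low [0..<m] @ map Up (rev [0..<k])"

text \<open>A labelling \<open>(gen (i 1), \<dots>, gen (i (k + m)))\<close> is given by the list of its indices.\<close>

definition labelling :: "nat \<Rightarrow> nat \<Rightarrow> part \<Rightarrow> nat list \<Rightarrow> bool" where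
  "labelling k m p ls \<longleftrightarrow>
     length ls = k + m \<and>
     (\<forall>r<k + m. \<forall>s<k + m.
        ls ! r = ls ! s \<longleftrightarrow> (\<exists>B\<in>p. boundary k m ! r \<in> B \<and> boundary k m ! s \<in> B))"

definition word :: "nat list \<Rightarrow> z2word" where
  "word ls = foldr (\<lambda>i x. gen i \<otimes>\<^bsub>Z2inf\<^esub> x) ls \<one>\<^bsub>Z2inf\<^esub>"

section \<open>The semigroup of identifications of letters\<close>

inductive_set sS_inf :: "(z2word \<Rightarrow> z2word) set" where
  ident: "\<lbrakk>\<phi> \<in> hom Z2inf Z2inf; \<forall>k<n. \<phi> (gen k) = gen (i k); \<forall>k\<ge>n. \<phi> (gen k) = gen k\<rbrakk>
        \<Longrightarrow> \<phi> \<in> sS_inf"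
| comp: "\<lbrakk>\<phi> \<in> sS_inf; \<psi> \<in> sS_inf\<rbrakk> \<Longrightarrow> \<phi> \<circ> \<psi> \<in> sS_inf"

definition sS_invariant :: "z2word set \<Rightarrow> bool" where
  "sS_invariant H \<longleftrightarrow> (\<forall>\<phi>\<in>sS_inf. \<phi> ` H \<subseteq> H)"

section \<open>The two maps\<close>

definition F_of :: "part_family \<Rightarrow> z2word set" where
  "F_of C = {word ls | k m p ls. p \<in> C k m \<and> labelling k m p ls}"

definition C_of :: "z2word set \<Rightarrow> part_family" where
  "C_of H k m = {p \<in> partitions k m. \<exists>ls. labelling k m p ls \<and> word ls \<in> H}"

section \<open>The two lattices\<close>

definition gt_categories :: "part_family gorder" where
  "gt_categories = \<lparr>carrier = {C. group_theoretical C}, eq = (=), le = (\<le>)\<rparr>"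

definition invariant_normal_subgroups :: "z2word set gorder" where
  "invariant_normal_subgroups =
     \<lparr>carrier = {H. H \<lhd> Z2inf \<and> sS_invariant H}, eq = (=), le = (\<subseteq>)\<rparr>"

text \<open>The meets are intersections (for families of partitions, \<open>inf\<close> is the
  intersection for all \<open>k\<close> and \<open>l\<close>). The joins are least upper bounds by definition.\<close>

lemma meet_eq_inf:
  fixes x y :: "'a :: lattice"
  assumes "x \<in> S" "y \<in> S" "inf x y \<in> S"
  shows "x \<sqinter>\<^bsub>\<lparr>carrier = S, eq = (=), le = (\<le>)\<rparr>\<^esub> y = inf x y"
proof -
  have "greatest \<lparr>carrier = S, eq = (=), le = (\<le>)\<rparr> z
          (Lower \<lparr>carrier = S, eq = (=), le = (\<le>)\<rparr> {x, y}) \<longleftrightarrow> z = inf x y" for z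
    using assms by (auto simp: greatest_def Lower_def intro: order.antisym)
  then show ?thesis
    by (simp add: meet_def Lattice.inf_def)
qed

lemma meet_gt_categories:
  assumes "group_theoretical C" "group_theoretical D"
  shows "C \<sqinter>\<^bsub>gt_categories\<^esub> D = inf C D"
proof -
  interpret C: group_theoretical C by fact
  interpret D: group_theoretical D by fact
  have "group_theoretical (\<lambda>k l. C k l \<inter> D k l)"
  proof unfold_locales
    show "C k l \<inter> D k l \<subseteq> partitions k l" for k l
      using C.subset_partitions by blast
    show "composition q p \<in> C k m \<inter> D k m"
      if "p \<in> C k l \<inter> D k l" "q \<in> C l m \<inter> D l m" for p q k l m
      using that C.composition D.composition by blast
  qed (use C.id_part D.id_part in \<open>simp_all add: C.tensor D.tensor C.involution D.involution
      C.rot_left_down D.rot_left_down C.rot_left_up D.rot_left_up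
      C.rot_right_down D.rot_right_down C.rot_right_up D.rot_right_up
      C.pair_positioner D.pair_positioner\<close>)
  then have "group_theoretical (inf C D)"
    by (simp only: inf_fun_def)
  with assms show ?thesis
    unfolding gt_categories_def by (intro meet_eq_inf) simp_all
qed

lemma meet_invariant_normal_subgroups:
  assumes "H \<lhd> Z2inf" "sS_invariant H" "K \<lhd> Z2inf" "sS_invariant K"
  shows "H \<sqinter>\<^bsub>invariant_normal_subgroups\<^esub> K = H \<inter> K"
proof -
  interpret group Z2inf by (rule group_Z2inf)
  have "(H \<inter> K) \<lhd> Z2inf"
    by (rule normal_subgroup_intersect) fact+
  moreover have "sS_invariant (H \<inter> K)"
    using assms unfolding sS_invariant_def by blast
  ultimately show ?thesis
    using assms unfolding invariant_normal_subgroups_def by (intro meet_eq_inf) simp_all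
qed

end

theory Submission
  imports Defs
begin

text \<open>A partition is the partition into fibres of a labelling of its points, and reading the labels
  counterclockwise turns it into a word. Since labels matter only up to renaming, a family of
  partitions corresponds to a set of words that is stable under injective renaming of letters, and
  the rotations say that only the word matters, not how its letters are distributed over the two
  rows (\<open>has_iff_word\<close>). So everything can be computed with words.

  From categories to subgroups. Composing a word \<open>xs m ys\<close> with the tensor product of identities, a
  partition \<open>q\<close> of the category and identities rewrites the middle piece \<open>m\<close> according to \<open>q\<close>
  (\<open>has_apply_within\<close>). With the pair partition this deletes \<open>a a\<close>, and with the pair positioner it
  moves \<open>a a\<close> past any letter. Closing one pair of neighbours of the pair positioner \<open>b a a b a a\<close>
  produces the block with four points, and this block merges two neighbouring letters of a word. The
  rest follows: a pair \<open>b b\<close> with fresh \<open>b\<close> can be put anywhere by tensoring and moving it, and it can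
  be merged with an occurring letter, so pairs with an arbitrary letter can be inserted
  (\<open>has_insert_pair\<close>); and any two letters \<open>a\<close> and \<open>b\<close> can be merged, by inserting \<open>b b\<close> next to \<open>a\<close>,
  merging neighbours and deleting a pair (\<open>has_merge\<close>). Hence the set of words of the category is
  closed under arbitrary maps of letters and under the word equality of the free product. This gives
  invariance, it turns the tensor product (whose factors have disjoint letters) into multiplication,
  involution into inversion, and rotation into conjugation. Moreover, membership of a word depends
  only on the group element it represents (\<open>has_weq\<close>), so that no partition is added when passing to
  the subgroup and back.

  From subgroups to categories. By invariance it does not matter which labelling is tested
  (\<open>part_of_in_iff\<close>). Tensor products, involutions and rotations then become products, conjugates and
  inverses. For a composition, label the connected components of the three-row diagram: this labels
  both factors compatibly, perhaps with some letters merged, and in the product of the two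
  words the middle row cancels (\<open>composition_in\<close>).

  Both maps are monotone, so they form an isomorphism of ordered sets, and such an isomorphism
  preserves meets and joins.\<close>

section \<open>Partitions as fibres of labellings\<close>

definition fibres :: "'p set \<Rightarrow> ('p \<Rightarrow> 'a) \<Rightarrow> 'p set set" where
  "fibres S L = (\<lambda>x. {y \<in> S. L y = L x}) ` S"

lemma Union_fibres [simp]: "\<Union>(fibres S L) = S"
  by (auto simp: fibres_def)

lemma partition_on_fibres: "partition_on S (fibres S L)"
  by (rule partition_onI) (auto simp: fibres_def disjnt_def)

lemma fibres_cong:
  assumes "\<And>x y. x \<in> S \<Longrightarrow> y \<in> S \<Longrightarrow> L x = L y \<longleftrightarrow> M x = M y"
  shows "fibres S L = fibres S M"
  unfolding fibres_def using assms by (intro image_cong refl) auto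

lemma relabel_fibres:
  assumes "\<And>x. x \<in> S \<Longrightarrow> L (f x) = M x" "f ` S = T"
  shows "relabel f (fibres S M) = fibres T L"
proof -
  have "f ` {y \<in> S. M y = M x} = {z \<in> T. L z = L (f x)}" if "x \<in> S" for x
    using assms that by auto
  then have "relabel f (fibres S M) = (\<lambda>x. {z \<in> T. L z = L (f x)}) ` S"
    unfolding relabel_def fibres_def image_image by (intro image_cong refl) auto
  then show ?thesis
    using assms(2) by (auto simp: fibres_def)
qed

text \<open>Without a common value on \<open>S\<close> and \<open>T\<close>, no fibre meets both sets; tensor products have this form.\<close>

lemma fibres_Un:
  assumes "L ` S \<inter> L ` T = {}"
  shows "fibres (S \<union> T) L = fibres S L \<union> fibres T L"
proof -
  have "{y \<in> S \<union> T. L y = L x} = {y \<in> S. L y = L x}" if "x \<in> S" for x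
    using assms that by force
  moreover have "{y \<in> S \<union> T. L y = L x} = {y \<in> T. L y = L x}" if "x \<in> T" for x
    using assms that by force
  ultimately show ?thesis
    unfolding fibres_def image_Un by (metis (no_types, lifting) image_cong)
qed

lemma fibres_related_iff:
  "(x, y) \<in> (\<Union>B\<in>fibres S L. B \<times> B) \<longleftrightarrow> x \<in> S \<and> y \<in> S \<and> L x = L y"
  by (auto simp: fibres_def)

lemma partition_on_eq_fibres_iff:
  assumes "partition_on S p"
  shows "p = fibres S L \<longleftrightarrow> (\<forall>x\<in>S. \<forall>y\<in>S. L x = L y \<longleftrightarrow> (\<exists>B\<in>p. x \<in> B \<and> y \<in> B))"
proof
  assume "p = fibres S L"
  then show "\<forall>x\<in>S. \<forall>y\<in>S. L x = L y \<longleftrightarrow> (\<exists>B\<in>p. x \<in> B \<and> y \<in> B)"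
    by (auto simp: fibres_def)
next
  assume *: "\<forall>x\<in>S. \<forall>y\<in>S. L x = L y \<longleftrightarrow> (\<exists>B\<in>p. x \<in> B \<and> y \<in> B)"
  have S: "\<Union>p = S" and ne: "{} \<notin> p" and disj: "disjoint p"
    using assms by (auto simp: partition_on_def)
  have block: "B = {y \<in> S. L y = L x}" if "B \<in> p" "x \<in> B" for B x
  proof -
    have "x \<in> S" using S that by auto
    have "y \<in> B" if "y \<in> S" "L y = L x" for y
    proof -
      have "L x = L y \<longleftrightarrow> (\<exists>B\<in>p. x \<in> B \<and> y \<in> B)"
        using * \<open>x \<in> S\<close> \<open>y \<in> S\<close> by simp
      then obtain B' where "B' \<in> p" "x \<in> B'" "y \<in> B'"
        using \<open>L y = L x\<close> by auto
      then show ?thesis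
        using disjointD[OF disj \<open>B \<in> p\<close> \<open>B' \<in> p\<close>] \<open>x \<in> B\<close> by blast
    qed
    moreover have "y \<in> S \<and> L y = L x" if "y \<in> B" for y
    proof
      show "y \<in> S" using S \<open>B \<in> p\<close> \<open>y \<in> B\<close> by auto
      then have "L x = L y \<longleftrightarrow> (\<exists>B\<in>p. x \<in> B \<and> y \<in> B)"
        using * \<open>x \<in> S\<close> by simp
      then show "L y = L x" using \<open>B \<in> p\<close> \<open>x \<in> B\<close> \<open>y \<in> B\<close> by auto
    qed
    ultimately show ?thesis by blast
  qed
  show "p = fibres S L"
  proof
    show "p \<subseteq> fibres S L"
    proof
      fix B assume "B \<in> p"
      then obtain x where "x \<in> B" using ne by (metis equals0I)
      then show "B \<in> fibres S L"
        using block[OF \<open>B \<in> p\<close> \<open>x \<in> B\<close>] S \<open>B \<in> p\<close> unfolding fibres_def by auto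
    qed
    show "fibres S L \<subseteq> p"
    proof
      fix B assume "B \<in> fibres S L"
      then obtain x where "x \<in> S" "B = {y \<in> S. L y = L x}" by (auto simp: fibres_def)
      moreover obtain B' where "B' \<in> p" "x \<in> B'" using S \<open>x \<in> S\<close> by auto
      ultimately show "B \<in> p" using block by simp
    qed
  qed
qed

text \<open>The blocks are numbered, and each point is labelled by the number of its block.\<close>

lemma partition_on_obtain_fibres:
  assumes "partition_on S p" "finite S"
  obtains L :: "'p \<Rightarrow> nat" where "p = fibres S L"
proof -
  have "finite p" by (rule finite_elements[OF assms(2,1)])
  then obtain h :: "'p set \<Rightarrow> nat" where h: "inj_on h p"
    using finite_imp_inj_to_nat_seg by metis
  have ex1: "\<exists>!B. B \<in> p \<and> x \<in> B" if "x \<in> S" for x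
    using assms(1) that unfolding partition_on_def disjoint_def by (metis IntI UnionE empty_iff)
  define blk where "blk x = (THE B. B \<in> p \<and> x \<in> B)" for x
  have blk: "blk x \<in> p \<and> x \<in> blk x" if "x \<in> S" for x
    unfolding blk_def by (rule theI'[OF ex1[OF that]])
  have "p = fibres S (h \<circ> blk)"
    unfolding partition_on_eq_fibres_iff[OF assms(1)] o_def
    using blk ex1 h by (metis inj_onD)
  then show thesis by (rule that)
qed

lemma labels_factor:
  assumes "\<And>x y. x \<in> S \<Longrightarrow> y \<in> S \<Longrightarrow> L x = L y \<Longrightarrow> M x = M y"
  obtains f where "\<And>x. x \<in> S \<Longrightarrow> M x = f (L x)"
proof -
  have "M x = M (inv_into S L (L x))" if "x \<in> S" for x
    using that by (intro assms) (auto simp: inv_into_into f_inv_into_f)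
  then show thesis by (intro that[of "\<lambda>a. M (inv_into S L a)"]) auto
qed

section \<open>Labelled rows\<close>

definition rows :: "nat \<Rightarrow> nat \<Rightarrow> nat \<Rightarrow> point set" where
  "rows k m l = Up ` {..<k} \<union> Mid ` {..<m} \<union> Low ` {..<l}"

primrec lab :: "'a list \<Rightarrow> 'a list \<Rightarrow> 'a list \<Rightarrow> point \<Rightarrow> 'a" where
  "lab us ms ls (Up i) = us ! i"
| "lab us ms ls (Mid i) = ms ! i"
| "lab us ms ls (Low i) = ls ! i"

text \<open>The type of the letters is left open, so that disjoint alphabets can be formed as sum types and
  fresh letters need not be chosen.\<close>

definition part_of :: "'a list \<Rightarrow> 'a list \<Rightarrow> part" where
  "part_of us ls = fibres (points (length us) (length ls)) (lab us [] ls)"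

lemma points_eq_rows: "points k l = rows k 0 l"
  by (simp add: points_def rows_def)

lemma in_rows [simp]:
  "Up i \<in> rows k m l \<longleftrightarrow> i < k" "Mid i \<in> rows k m l \<longleftrightarrow> i < m" "Low i \<in> rows k m l \<longleftrightarrow> i < l"
  by (auto simp: rows_def)

lemma in_points [simp]:
  "Up i \<in> points k l \<longleftrightarrow> i < k" "Mid i \<notin> points k l" "Low i \<in> points k l \<longleftrightarrow> i < l"
  by (auto simp: points_def)

lemma finite_rows [simp]: "finite (rows k m l)"
  by (simp add: rows_def)

lemma lab_map: "x \<in> rows (length us) (length ms) (length ls) \<Longrightarrow>
    lab (map f us) (map f ms) (map f ls) x = f (lab us ms ls x)"
  by (cases x) auto

lemma lab_in: "x \<in> rows (length us) (length ms) (length ls) \<Longrightarrow>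
    lab us ms ls x \<in> set us \<union> set ms \<union> set ls"
  by (cases x) auto

lemma part_of_partition: "part_of us ls \<in> partitions (length us) (length ls)"
  by (simp add: partitions_def part_of_def partition_on_fibres)

lemma obtain_part_of:
  assumes "p \<in> partitions k l"
  obtains us ls :: "nat list" where "length us = k" "length ls = l" "p = part_of us ls"
proof -
  have "finite (points k l)" by (simp add: points_def)
  then obtain L :: "point \<Rightarrow> nat" where L: "p = fibres (points k l) L"
    using partition_on_obtain_fibres assms unfolding partitions_def by blast
  define us ls where "us = map (L \<circ> Up) [0..<k]" and "ls = map (L \<circ> Low) [0..<l]"
  have len: "length us = k" "length ls = l" by (auto simp: us_def ls_def)
  have "L x = lab us [] ls x" if "x \<in> points k l" for x
    using that by (cases x) (auto simp: us_def ls_def)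
  then have "p = part_of us ls"
    unfolding L part_of_def len by (intro fibres_cong) auto
  with len show thesis by (rule that)
qed

lemma part_of_cong:
  assumes "length us = length us'" "length ls = length ls'"
    and "\<And>x y. x \<in> points (length us) (length ls) \<Longrightarrow> y \<in> points (length us) (length ls)
       \<Longrightarrow> lab us [] ls x = lab us [] ls y \<longleftrightarrow> lab us' [] ls' x = lab us' [] ls' y"
  shows "part_of us ls = part_of us' ls'"
  unfolding part_of_def assms(1,2)[symmetric] by (rule fibres_cong) (rule assms(3))

lemma part_of_map_inj:
  assumes "inj_on f (set us \<union> set ls)"
  shows "part_of (map f us) (map f ls) = part_of us ls"
proof (rule part_of_cong)
  fix x y assume xy: "x \<in> points (length (map f us)) (length (map f ls))"
    "y \<in> points (length (map f us)) (length (map f ls))"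
  have "lab (map f us) [] (map f ls) z = f (lab us [] ls z)"
    "lab us [] ls z \<in> set us \<union> set ls"
    if "z \<in> points (length (map f us)) (length (map f ls))" for z
    using that lab_map[of z us "[]" ls f] lab_in[of z us "[]" ls] by (auto simp: points_eq_rows)
  with xy show "lab (map f us) [] (map f ls) x = lab (map f us) [] (map f ls) y
      \<longleftrightarrow> lab us [] ls x = lab us [] ls y"
    using assms by (metis inj_onD)
qed auto

text \<open>Two labellings of the same partition differ by a renaming of letters.\<close>

lemma part_of_eqD:
  assumes "part_of us ls = part_of us' ls'" "length us = length us'" "length ls = length ls'"
  obtains f where "us' = map f us" "ls' = map f ls"
proof -
  let ?S = "points (length us) (length ls)"
  have rel: "(x, y) \<in> (\<Union>B\<in>part_of us ls. B \<times> B) \<longleftrightarrow> x \<in> ?S \<and> y \<in> ?S \<and> lab us [] ls x = lab us [] ls y"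
    "(x, y) \<in> (\<Union>B\<in>part_of us' ls'. B \<times> B) \<longleftrightarrow> x \<in> ?S \<and> y \<in> ?S \<and> lab us' [] ls' x = lab us' [] ls' y"
    for x y
    using assms(2,3) by (simp_all only: part_of_def fibres_related_iff)
  then have "lab us' [] ls' x = lab us' [] ls' y"
    if "x \<in> ?S" "y \<in> ?S" "lab us [] ls x = lab us [] ls y" for x y
    using that assms(1) by metis
  then obtain f where f: "\<And>x. x \<in> ?S \<Longrightarrow> lab us' [] ls' x = f (lab us [] ls x)"
    using labels_factor[of ?S "lab us [] ls" "lab us' [] ls'"] by metis
  show thesis
  proof (rule that)
    show "us' = map f us"
      using f[of "Up _"] assms(2) by (intro nth_equalityI) auto
    show "ls' = map f ls"
      using f[of "Low _"] assms(3) by (intro nth_equalityI) auto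
  qed
qed

section \<open>The category operations on labelled rows\<close>

lemma tensor_part_of:
  fixes us ls :: "'a list" and us' ls' :: "'b list"
  shows "tensor (length us) (length ls) (part_of us ls) (part_of us' ls')
     = part_of (map Inl us @ map Inr us') (map Inl ls @ map Inr ls')"
proof -
  let ?L = "lab (map Inl us @ map Inr us') [] (map Inl ls @ map Inr ls')"
  let ?S = "points (length us) (length ls)"
  let ?T = "shift (length us) (length ls) ` points (length us') (length ls')"
  have S: "part_of us ls = fibres ?S ?L"
  proof -
    have "?L x = Inl (lab us [] ls x)" if "x \<in> ?S" for x
      using that by (cases x) (auto simp: nth_append)
    then show ?thesis unfolding part_of_def by (intro fibres_cong) auto
  qed
  have L_shift: "?L (shift (length us) (length ls) x) = Inr (lab us' [] ls' x)"
    if "x \<in> points (length us') (length ls')" for x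
    using that by (cases x) (auto simp: nth_append)
  have "part_of us' ls' = fibres (points (length us') (length ls')) ((Inr :: 'b \<Rightarrow> 'a + 'b) \<circ> lab us' [] ls')"
    unfolding part_of_def by (intro fibres_cong) auto
  also have "relabel (shift (length us) (length ls)) \<dots> = fibres ?T ?L"
    by (rule relabel_fibres) (use L_shift in auto)
  finally have T: "relabel (shift (length us) (length ls)) (part_of us' ls') = fibres ?T ?L" .
  have disj: "?L ` ?S \<inter> ?L ` ?T = {}"
  proof -
    have "?L ` ?S \<subseteq> range Inl"
    proof (rule image_subsetI)
      fix x assume "x \<in> ?S"
      then show "?L x \<in> range Inl" by (cases x) (auto simp: nth_append)
    qed
    moreover have "?L ` ?T \<subseteq> range Inr"
      using L_shift by auto
    moreover have "range (Inl :: 'a \<Rightarrow> 'a + 'b) \<inter> range Inr = {}" by auto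
    ultimately show ?thesis by (meson disjoint_iff subsetD)
  qed
  have "points (length us + length us') (length ls + length ls') = ?S \<union> ?T"
  proof -
    have *: "{..<a + b} = {..<a} \<union> (+) a ` {..<b}" for a b :: nat
      by (auto simp: lessThan_atLeast0 add.commute)
    show ?thesis unfolding points_def * image_Un by (auto simp: image_image)
  qed
  then show ?thesis
    unfolding tensor_def S T using fibres_Un[OF disj] by (simp add: part_of_def)
qed

lemma involution_part_of: "involution (part_of us ls) = part_of ls us"
  unfolding involution_def part_of_def
proof (rule relabel_fibres)
  show "flip ` points (length us) (length ls) = points (length ls) (length us)"
    by (auto simp: points_def image_Un image_image)
qed (auto simp: points_def)

lemma rot_left_down_part_of:
  "relabel rot_left_down (part_of (x # us) ls) = part_of us (x # ls)"
  unfolding part_of_def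
proof (rule relabel_fibres)
  show "rot_left_down ` points (length (x # us)) (length ls) = points (length us) (length (x # ls))"
    by (auto simp: points_def image_Un image_image lessThan_Suc_eq_insert_0)
qed (auto simp: points_def split: nat.splits)

lemma rot_left_up_part_of:
  "relabel rot_left_up (part_of us (x # ls)) = part_of (x # us) ls"
  unfolding part_of_def
proof (rule relabel_fibres)
  show "rot_left_up ` points (length us) (length (x # ls)) = points (length (x # us)) (length ls)"
    by (auto simp: points_def image_Un image_image lessThan_Suc_eq_insert_0)
qed (auto simp: points_def split: nat.splits)

lemma rot_right_down_part_of:
  "relabel (rot_right_down (length us) (length ls)) (part_of (us @ [x]) ls) = part_of us (ls @ [x])"
  unfolding part_of_def
proof (rule relabel_fibres)
  show "rot_right_down (length us) (length ls) ` points (length (us @ [x])) (length ls)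
      = points (length us) (length (ls @ [x]))"
    by (auto simp: points_def image_Un image_image lessThan_Suc rot_right_down_def)
qed (auto simp: points_def rot_right_down_def nth_append less_Suc_eq)

lemma rot_right_up_part_of:
  "relabel (rot_right_up (length us) (length ls)) (part_of us (ls @ [x])) = part_of (us @ [x]) ls"
  unfolding part_of_def
proof (rule relabel_fibres)
  show "rot_right_up (length us) (length ls) ` points (length us) (length (ls @ [x]))
      = points (length (us @ [x])) (length ls)"
    by (auto simp: points_def image_Un image_image lessThan_Suc rot_right_up_def)
qed (auto simp: points_def rot_right_up_def nth_append less_Suc_eq)

lemma id_part_eq: "id_part = part_of [x] [x]"
  by (auto simp: id_part_def part_of_def fibres_def points_def)

lemma pair_positioner_eq:
  assumes "a \<noteq> b"
  shows "pair_positioner = part_of [a, a, b] [b, a, a]"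
proof -
  have points: "points (Suc (Suc (Suc 0))) (Suc (Suc (Suc 0)))
      = {Up 0, Up (Suc 0), Up (Suc (Suc 0)), Low 0, Low (Suc 0), Low (Suc (Suc 0))}"
    by (auto simp: points_def lessThan_Suc)
  let ?S = "points (Suc (Suc (Suc 0))) (Suc (Suc (Suc 0)))" and ?L = "lab [a, a, b] [] [b, a, a]"
  have "{y \<in> ?S. ?L y = a} = {Up 0, Up 1, Low 1, Low 2}" "{y \<in> ?S. ?L y = b} = {Up 2, Low 0}"
    using assms unfolding points by (auto simp: numeral_2_eq_2)
  then have "fibres ?S ?L = {{Up 0, Up 1, Low 1, Low 2}, {Up 2, Low 0}}"
    unfolding fibres_def by (subst (2) points) auto
  then show ?thesis
    by (simp add: part_of_def pair_positioner_def)
qed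

text \<open>Whether two points lie in a common block of the three-row diagram becomes a comparison of letters.\<close>

lemma glue_part_of:
  assumes "length ms = length ms'"
  shows "glue (part_of us ms) (part_of ms' ls) =
    fibres (rows (length us) (length ms) 0) (lab us ms []) \<union>
    fibres (rows 0 (length ms) (length ls)) (lab [] ms' ls)"
proof -
  have "relabel low_to_mid (part_of us ms) = fibres (rows (length us) (length ms) 0) (lab us ms [])"
    unfolding part_of_def
    by (rule relabel_fibres) (auto simp: points_def rows_def image_Un image_image)
  moreover have "relabel up_to_mid (part_of ms' ls) = fibres (rows 0 (length ms) (length ls)) (lab [] ms' ls)"
    unfolding part_of_def
    by (rule relabel_fibres) (auto simp: points_def rows_def image_Un image_image assms)
  ultimately show ?thesis by (simp add: glue_def)
qed

text \<open>Composition is described by any labelling \<open>L\<close> of the three rows that separates exactly the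
  connected components of the diagram. Every component meets the outer rows in a fibre of \<open>L\<close> or
  lies in the middle row and disappears.\<close>

lemma composition_part_of:
  fixes us ms :: "'a list" and ms' ls :: "'b list" and L :: "point \<Rightarrow> 'c"
  assumes len: "length ms = length ms'"
  defines "T \<equiv> rows (length us) (length ms) (length ls)"
  defines "R \<equiv> connected_in (glue (part_of us ms) (part_of ms' ls))"
  assumes conn: "\<And>x y. x \<in> T \<Longrightarrow> y \<in> T \<Longrightarrow> (x, y) \<in> R \<longleftrightarrow> L x = L y"
  shows "composition (part_of ms' ls) (part_of us ms) = fibres (points (length us) (length ls)) L"
proof -
  let ?G = "glue (part_of us ms) (part_of ms' ls)"
  let ?S = "points (length us) (length ls)"
  have T: "\<Union>?G = T"
    unfolding glue_part_of[OF len] Union_Un_distrib Union_fibres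
    by (auto simp: T_def rows_def)
  have "R \<subseteq> T \<times> T"
    unfolding R_def connected_in_def by (rule trancl_subset_Sigma) (use T in blast)
  then have "R `` {x} = {y \<in> T. L y = L x}" if "x \<in> T" for x
    using conn that by auto
  then have classes: "T // R = fibres T L"
    unfolding quotient_def fibres_def by auto
  have S: "?S = T - range Mid"
    by (auto simp: T_def rows_def points_def)
  have "(\<lambda>B. B - range Mid) ` fibres T L - {{}} = fibres ?S L"
  proof
    show "(\<lambda>B. B - range Mid) ` fibres T L - {{}} \<subseteq> fibres ?S L"
    proof
      fix B assume B: "B \<in> (\<lambda>B. B - range Mid) ` fibres T L - {{}}"
      then obtain x where x: "x \<in> T" "B = {y \<in> T. L y = L x} - range Mid"
        by (auto simp: fibres_def)
      with B obtain z where "z \<in> B" by auto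
      with x have "z \<in> ?S" "B = {y \<in> ?S. L y = L z}" by (auto simp: S)
      then show "B \<in> fibres ?S L" by (auto simp: fibres_def)
    qed
    show "fibres ?S L \<subseteq> (\<lambda>B. B - range Mid) ` fibres T L - {{}}"
    proof
      fix B assume "B \<in> fibres ?S L"
      then obtain x where x: "x \<in> ?S" "B = {y \<in> ?S. L y = L x}"
        by (auto simp: fibres_def)
      then have "B = {y \<in> T. L y = L x} - range Mid" "B \<noteq> {}" "x \<in> T"
        by (auto simp: S)
      then show "B \<in> (\<lambda>B. B - range Mid) ` fibres T L - {{}}"
        by (auto simp: fibres_def)
    qed
  qed
  then show ?thesis
    unfolding composition_def T R_def[symmetric] classes .
qed

section \<open>Words in a category of partitions\<close>

context category_of_partitions
begin

definition has :: "'a list \<Rightarrow> 'a list \<Rightarrow> bool" where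
  "has us ls \<longleftrightarrow> part_of us ls \<in> C (length us) (length ls)"

lemma has_map_inj:
  "inj_on f (set us \<union> set ls) \<Longrightarrow> has (map f us) (map f ls) \<longleftrightarrow> has us ls"
  by (simp add: has_def part_of_map_inj)

lemma has_tensor:
  "has us ls \<Longrightarrow> has us' ls' \<Longrightarrow> has (map Inl us @ map Inr us') (map Inl ls @ map Inr ls')"
  unfolding has_def using tensor[of "part_of us ls" "length us" "length ls" "part_of us' ls'" "length us'" "length ls'"]
  by (simp add: tensor_part_of)

lemma has_involution: "has us ls \<longleftrightarrow> has ls us"
  unfolding has_def using involution involution_part_of by metis

lemma has_rotate_left: "has (x # us) ls \<longleftrightarrow> has us (x # ls)"
  unfolding has_def
  using rot_left_down[of "part_of (x # us) ls" "length us" "length ls"]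
    rot_left_up[of "part_of us (x # ls)" "length us" "length ls"]
  by (auto simp: rot_left_down_part_of rot_left_up_part_of)

lemma has_rotate_right: "has (us @ [x]) ls \<longleftrightarrow> has us (ls @ [x])"
  unfolding has_def
  using rot_right_down[of "part_of (us @ [x]) ls" "length us" "length ls"]
    rot_right_up[of "part_of us (ls @ [x])" "length us" "length ls"]
  by (auto simp: rot_right_down_part_of rot_right_up_part_of)

text \<open>Moving the upper points to the lower row on the right keeps the counterclockwise reading.\<close>

lemma has_iff_word: "has us ls \<longleftrightarrow> has [] (ls @ rev us)"
  by (induction us arbitrary: ls rule: rev_induct) (simp_all add: has_rotate_right)

lemma has_cyclic: "has [] (x # xs) \<longleftrightarrow> has [] (xs @ [x])"
  using has_rotate_left[of x "[]" xs] has_rotate_right[of "[]" x xs] by simp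

lemma has_rev: "has [] (rev xs) \<longleftrightarrow> has [] xs"
  using has_iff_word[of xs "[]"] has_involution[of xs "[]"] by simp

lemma has_id: "has [x] [x]"
  using id_part by (simp add: has_def id_part_eq[of x])

lemma has_pair: "has [] [x, x]"
  using has_id[of x] has_iff_word[of "[x]" "[x]"] by simp

text \<open>Composing a word \<open>w\<close> with a partition \<open>q\<close> whose upper row is \<open>ms\<close> and whose lower row is \<open>ds\<close>. In the
  composition, letters of \<open>w\<close> that stand above the same letter of \<open>ms\<close> become equal; the map \<open>f\<close> performs
  this identification and \<open>g\<close> transports it to the letters of \<open>q\<close>. The last hypothesis says that \<open>f\<close>
  identifies no more than the diagram forces, in the simple situation where each identification is due
  to a single letter of \<open>ms\<close>. Blocks of \<open>q\<close> inside its lower row are excluded, so that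
  each remaining point is connected to the middle row.\<close>

lemma has_apply:
  assumes w: "has [] w" and q: "has ms ds"
    and len: "length w = length ms" and ds: "set ds \<subseteq> set ms"
    and fg: "map f w = map g ms"
    and merge: "\<And>a b. f a = f b \<Longrightarrow> a = b \<or>
      (\<exists>r s. r < length w \<and> s < length w \<and> w ! r = a \<and> w ! s = b \<and> ms ! r = ms ! s)"
  shows "has [] (map g ds)"
proof -
  let ?G = "glue (part_of [] w) (part_of ms ds)"
  let ?L = "lab [] (map f w) (map g ds)"
  let ?T = "rows 0 (length w) (length ds)"
  define E where "E = (\<Union>B\<in>?G. B \<times> B)"
  have R: "connected_in ?G = E\<^sup>+" by (simp add: connected_in_def E_def)
  have E_iff: "(x, y) \<in> E \<longleftrightarrow>
      x \<in> rows 0 (length w) 0 \<and> y \<in> rows 0 (length w) 0 \<and> lab [] w [] x = lab [] w [] y \<or>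
      x \<in> ?T \<and> y \<in> ?T \<and> lab [] ms ds x = lab [] ms ds y" for x y
    unfolding E_def glue_part_of[OF len] UN_Un Un_iff fibres_related_iff by simp
  have L: "?L x = g (lab [] ms ds x)" if "x \<in> ?T" for x
    using lab_map[of x "[]" ms ds g] that len by (simp add: fg)
  have L_Mid: "?L x = f (lab [] w [] x)" if "x \<in> rows 0 (length w) 0" for x
    using lab_map[of x "[]" w "[]" f] that by (cases x) simp_all
  have E_L: "?L x = ?L y" if "(x, y) \<in> E" for x y
    using that L L_Mid unfolding E_iff by metis
  have "sym E" unfolding E_def sym_def by blast
  then have sym: "sym (E\<^sup>+)" by (rule sym_trancl)
  \<comment> \<open>It suffices to compare middle points, as every point has a common block with one of them.\<close>
  have to_Mid: "\<exists>r < length w. (x, Mid r) \<in> E" if "x \<in> ?T" for x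
  proof (cases x)
    case (Low j)
    then have "ds ! j \<in> set ms" using that ds by auto
    then obtain r where "r < length w" "ms ! r = ds ! j" using len by (metis in_set_conv_nth)
    then show ?thesis using Low that by (auto simp: E_iff)
  qed (use that in \<open>auto simp: E_iff\<close>)
  have Mid: "(Mid r, Mid s) \<in> E\<^sup>+"
    if rs: "r < length w" "s < length w" "f (w ! r) = f (w ! s)" for r s
    using merge[OF rs(3)]
  proof (elim disjE exE conjE)
    assume "w ! r = w ! s"
    then show ?thesis using rs by (intro r_into_trancl) (simp add: E_iff)
  next
    fix r' s' assume "r' < length w" "s' < length w" "w ! r' = w ! r" "w ! s' = w ! s" "ms ! r' = ms ! s'"
    then have "(Mid r, Mid r') \<in> E" "(Mid r', Mid s') \<in> E" "(Mid s', Mid s) \<in> E"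
      using rs by (simp_all add: E_iff)
    then show ?thesis by (meson trancl.simps)
  qed
  have conn: "(x, y) \<in> E\<^sup>+ \<longleftrightarrow> ?L x = ?L y" if "x \<in> ?T" "y \<in> ?T" for x y
  proof
    assume "(x, y) \<in> E\<^sup>+"
    then show "?L x = ?L y"
      by (induction rule: trancl_induct) (auto dest: E_L)
  next
    assume eq: "?L x = ?L y"
    obtain r s where rs: "r < length w" "(x, Mid r) \<in> E" "s < length w" "(y, Mid s) \<in> E"
      using to_Mid \<open>x \<in> ?T\<close> \<open>y \<in> ?T\<close> by meson
    then have "f (w ! r) = f (w ! s)"
      using E_L[of x "Mid r"] E_L[of y "Mid s"] eq by simp
    then have "(Mid r, Mid s) \<in> E\<^sup>+" using Mid rs by simp
    moreover have "(Mid s, y) \<in> E\<^sup>+" using rs sym by (meson r_into_trancl symD)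
    ultimately show "(x, y) \<in> E\<^sup>+" using rs(2) by (meson r_into_trancl trancl_trans)
  qed
  have "composition (part_of ms ds) (part_of [] w) = fibres (points 0 (length ds)) ?L"
    using composition_part_of[OF len, of "[]" ds ?L] conn by (simp add: R)
  also have "\<dots> = part_of [] (map g ds)"
    by (simp add: part_of_def, rule fibres_cong) (auto simp: points_def)
  finally show ?thesis
    using composition[of "part_of [] w" 0 "length w" "part_of ms ds"] w q len by (simp add: has_def)
qed

lemma has_cap: "has [x, x] []"
  using has_pair has_involution by metis

text \<open>The pair partition composed with its involution leaves no points.\<close>

lemma has_empty: "has ([] :: 'a list) ([] :: 'a list)"
  using has_apply[OF has_pair has_cap, of undefined undefined "id :: 'a \<Rightarrow> 'a" id] by simp

text \<open>The letters \<open>0, \<dots>, n - 1\<close> are distinct, so this is the identity partition on \<open>n\<close> points.\<close>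

lemma has_upt: "has [0..<n] [0..<n]"
proof (induction n)
  case 0
  show ?case by (simp add: has_empty)
next
  case (Suc n)
  define h where "h = case_sum id (\<lambda>_ :: unit. n)"
  let ?w = "map Inl [0..<n] @ map Inr [()]"
  have "has ?w ?w" using has_tensor[OF Suc has_id[of "()"]] by simp
  moreover have "inj_on h (set ?w \<union> set ?w)"
    by (auto simp: inj_on_def h_def)
  ultimately have "has (map h ?w) (map h ?w)" by (simp only: has_map_inj)
  moreover have "map h ?w = [0..<Suc n]" by (simp add: h_def o_def)
  ultimately show ?case by (simp only:)
qed

text \<open>The preceding rewriting applied to a part of a word, by tensoring with identities on both sides.
  The sum types keep the letters of the three factors apart.\<close>

lemma has_apply_within:
  assumes w: "has [] (xs @ m @ ys)" and r: "has us ls"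
    and len: "length m = length us" and ls: "set ls \<subseteq> set us"
    and fg: "map f m = map g us"
    and merge: "\<And>a b. f a = f b \<Longrightarrow> a = b \<or>
      (\<exists>r s. r < length m \<and> s < length m \<and> m ! r = a \<and> m ! s = b \<and> us ! r = us ! s)"
  shows "has [] (map f xs @ map g ls @ map f ys)"
proof -
  let ?q = "\<lambda>zs. map Inl (map Inl [0..<length xs] @ map Inr zs) @ map Inr [0..<length ys]"
  define g' where "g' = case_sum (case_sum (\<lambda>i. f (xs ! i)) g) (\<lambda>i. f (ys ! i))"
  have nth: "map (\<lambda>i. f (zs ! i)) [0..<length zs] = map f zs" for zs
    by (intro nth_equalityI) auto
  have g': "map g' (?q zs) = map f xs @ map g zs @ map f ys" for zs
    by (simp add: g'_def o_def nth)
  have "has [] (map g' (?q ls))"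
  proof (rule has_apply[OF w])
    show "has (?q us) (?q ls)"
      by (intro has_tensor has_upt r)
    show "length (xs @ m @ ys) = length (?q us)" by (simp add: len)
    show "set (?q ls) \<subseteq> set (?q us)" using ls by auto
    show "map f (xs @ m @ ys) = map g' (?q us)" unfolding g' by (simp add: fg)
    fix a b assume "f a = f b"
    from merge[OF this] show "a = b \<or> (\<exists>r s. r < length (xs @ m @ ys) \<and> s < length (xs @ m @ ys) \<and>
       (xs @ m @ ys) ! r = a \<and> (xs @ m @ ys) ! s = b \<and> ?q us ! r = ?q us ! s)"
    proof (elim disjE exE conjE)
      fix r s assume rs: "r < length m" "s < length m" "m ! r = a" "m ! s = b" "us ! r = us ! s"
      have *: "(xs @ m @ ys) ! (length xs + t) = m ! t" "?q us ! (length xs + t) = Inl (Inr (us ! t))"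
        if "t < length m" for t
        using that len by (simp_all add: nth_append)
      show ?thesis
        by (intro disjI2 exI[of _ "length xs + r"] exI[of _ "length xs + s"] conjI)
          (use rs * in simp_all)
    qed simp
  qed
  then show ?thesis by (simp only: g')
qed

lemma has_delete_pair:
  assumes "has [] (xs @ [i, i] @ ys)"
  shows "has [] (xs @ ys)"
proof -
  from has_apply_within[OF assms has_cap, of "()" id "\<lambda>_. i"] show ?thesis by simp
qed

end

section \<open>Words in a group-theoretical category\<close>

context group_theoretical
begin

lemma has_pair_positioner: "has [False, False, True] [True, False, False]"
  using pair_positioner pair_positioner_eq[of False True] by (simp add: has_def numeral_3_eq_3)

text \<open>The three middle letters are composed with the upper row \<open>x x y\<close> of the pair positioner, whose
  lower row is \<open>y x x\<close>; the converse uses its involution.\<close>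

lemma has_pair_past_letter: "has [] (xs @ [a, a, b] @ ys) \<longleftrightarrow> has [] (xs @ [b, a, a] @ ys)"
proof
  assume "has [] (xs @ [a, a, b] @ ys)"
  from has_apply_within[OF this has_pair_positioner, of id "\<lambda>t. if t then b else a"]
  show "has [] (xs @ [b, a, a] @ ys)" by auto
next
  have pp: "has [True, False, False] [False, False, True]"
    using has_pair_positioner has_involution by blast
  assume "has [] (xs @ [b, a, a] @ ys)"
  from has_apply_within[OF this pp, of id "\<lambda>t. if t then b else a"]
  show "has [] (xs @ [a, a, b] @ ys)" by auto
qed

lemma has_pair_past_word: "has [] (xs @ [a, a] @ zs @ ys) \<longleftrightarrow> has [] (xs @ zs @ [a, a] @ ys)"
proof (induction zs arbitrary: xs)
  case (Cons b zs)
  have "has [] (xs @ [a, a] @ (b # zs) @ ys) \<longleftrightarrow> has [] ((xs @ [b]) @ [a, a] @ zs @ ys)"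
    using has_pair_past_letter[of xs a b "zs @ ys"] by simp
  also have "\<dots> \<longleftrightarrow> has [] ((xs @ [b]) @ zs @ [a, a] @ ys)" by (rule Cons)
  finally show ?case by simp
qed simp

text \<open>The word of the pair positioner is \<open>b a a b a a\<close>. Closing its first two points by a pair partition
  merges \<open>a\<close> and \<open>b\<close> and leaves \<open>a a a a\<close>.\<close>

lemma has_four_block: "has [(), ()] [(), ()]"
proof -
  have "has [] ([] @ [True, False] @ [False, True, False, False])"
    using has_pair_positioner has_iff_word[of "[False, False, True]" "[True, False, False]"] by simp
  then have "has [] (map (\<lambda>_ :: bool. ()) [] @ map id [] @ map (\<lambda>_. ()) [False, True, False, False])"
    using has_cap[of "()"]
  proof (rule has_apply_within)
    fix a b :: bool
    have "[True, False] ! (if a then 0 else 1) = a" "[True, False] ! (if b then 0 else 1) = b" by auto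
    then show "a = b \<or> (\<exists>r s. r < length [True, False] \<and> s < length [True, False] \<and>
        [True, False] ! r = a \<and> [True, False] ! s = b \<and> [(), ()] ! r = [(), ()] ! s)"
      by (intro disjI2 exI[of _ "if a then 0 else 1"] exI[of _ "if b then 0 else 1"]) auto
  qed auto
  then show ?thesis using has_iff_word[of "[(), ()]" "[(), ()]"] by simp
qed

text \<open>Composing two neighbouring points with a block that contains two upper and two lower points
  merges their blocks and keeps both points.\<close>

lemma has_merge_adjacent:
  assumes "has [] (xs @ [i, j] @ ys)"
  shows "has [] (map (id(j := i)) (xs @ [i, j] @ ys))"
proof -
  let ?f = "id(j := i)"
  have "has [] (map ?f xs @ map (\<lambda>_. i) [(), ()] @ map ?f ys)"
  proof (rule has_apply_within[OF assms has_four_block])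
    fix a b assume "?f a = ?f b"
    then consider "a = b" | "a = i" "b = j" | "a = j" "b = i"
      by (auto split: if_splits)
    then show "a = b \<or> (\<exists>r s. r < length [i, j] \<and> s < length [i, j] \<and>
        [i, j] ! r = a \<and> [i, j] ! s = b \<and> [(), ()] ! r = [(), ()] ! s)"
    proof cases
      case 2
      then show ?thesis by (intro disjI2 exI[of _ 0] exI[of _ 1]) auto
    next
      case 3
      then show ?thesis by (intro disjI2 exI[of _ 1] exI[of _ 0]) auto
    qed simp
  qed auto
  also have "map ?f xs @ map (\<lambda>_. i) [(), ()] @ map ?f ys = map ?f (xs @ [i, j] @ ys)" by simp
  finally show ?thesis .
qed

text \<open>A pair in a fresh letter exists by tensoring. If \<open>i\<close> does not occur, rename the fresh letter to \<open>i\<close>;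
  otherwise move the pair next to an occurrence of \<open>i\<close>, merge, and move the pair on.\<close>

lemma has_insert_pair:
  assumes "has [] (xs @ ys)"
  shows "has [] (xs @ [i, i] @ ys)"
proof -
  define h where "h = case_sum (\<lambda>_ :: unit. i) id"
  have h_Inr: "map h (map Inr zs) = zs" for zs by (simp add: h_def o_def)
  have has_h: "has [] (map h w)" if "has [] w" "Inr i \<notin> set w" for w
  proof -
    have "inj_on h (set w)"
      using that(2) by (auto simp: inj_on_def h_def split: sum.splits)
    then show ?thesis using that(1) has_map_inj[of h "[]" w] by simp
  qed
  have fresh: "has [] ([] @ [Inl (), Inl ()] @ map Inr (xs @ ys))"
    using has_tensor[OF has_pair[of "()"] assms] by simp
  have "has [] ([] @ [i, i] @ (xs @ ys))"
  proof (cases "i \<in> set (xs @ ys)")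
    case False
    then show ?thesis using has_h[OF fresh] h_Inr[of "xs @ ys"] by (auto simp: h_def)
  next
    case True
    then obtain u v where uv: "xs @ ys = u @ i # v" by (meson split_list)
    \<comment> \<open>Merging eliminates \<open>Inr i\<close> in favour of the fresh letter, so that \<open>h\<close> is again injective on the
      letters of the word.\<close>
    let ?f = "id(Inr i := Inl ())"
    have h_f: "h (?f x) = h x" for x by (simp add: h_def)
    have "has [] (map Inr u @ [Inl (), Inl ()] @ map Inr (i # v))"
      using fresh has_pair_past_word[of "[]" "Inl ()" "map Inr u" "map Inr (i # v)"] by (simp add: uv)
    then have "has [] (map ?f ((map Inr u @ [Inl ()]) @ [Inl (), Inr i] @ map Inr v))"
      by (intro has_merge_adjacent) simp
    then have "has [] (map h (map ?f ((map Inr u @ [Inl ()]) @ [Inl (), Inr i] @ map Inr v)))"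
      by (rule has_h) auto
    also have "map h (map ?f ((map Inr u @ [Inl ()]) @ [Inl (), Inr i] @ map Inr v))
        = map h ((map Inr u @ [Inl ()]) @ [Inl (), Inr i] @ map Inr v)"
      unfolding map_map o_def h_f ..
    also have "\<dots> = u @ [i, i] @ i # v" by (simp add: h_def o_def)
    finally show ?thesis using has_pair_past_word[of "[]" i u "i # v"] uv by simp
  qed
  then show ?thesis using has_pair_past_word[of "[]" i xs ys] by simp
qed

text \<open>Insert \<open>b b\<close> after an occurrence of \<open>a\<close>. Merging the neighbours \<open>a b\<close> identifies the two letters
  everywhere and leaves three adjacent letters \<open>a a a\<close> in place of \<open>a\<close>; two of them cancel.\<close>

lemma has_merge:
  assumes "has [] w" "a \<in> set w"
  shows "has [] (map (id(b := a)) w)"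
proof -
  let ?f = "id(b := a)"
  obtain u v where w: "w = u @ a # v" using assms(2) by (meson split_list)
  have "has [] ((u @ [a]) @ [b, b] @ v)"
    using assms(1) by (intro has_insert_pair) (simp add: w)
  then have "has [] (map ?f (u @ [a, b] @ (b # v)))"
    by (intro has_merge_adjacent) simp
  also have "map ?f (u @ [a, b] @ (b # v)) = map ?f u @ [a, a] @ (a # map ?f v)" by simp
  finally have "has [] (map ?f u @ (a # map ?f v))" by (rule has_delete_pair)
  also have "map ?f u @ (a # map ?f v) = map ?f w" by (simp add: w)
  finally show ?thesis .
qed

text \<open>Every map of letters is a succession of merges of two letters, followed by an injective renaming.
  Each merge decreases the number of letters.\<close>

lemma has_map:
  assumes "has [] w"
  shows "has [] (map f w)"
  using assms
proof (induction "card (set w)" arbitrary: w rule: less_induct)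
  case less
  show ?case
  proof (cases "inj_on f (set w)")
    case True
    then show ?thesis using less.prems has_map_inj[of f "[]" w] by simp
  next
    case False
    then obtain a b where ab: "a \<in> set w" "b \<in> set w" "a \<noteq> b" "f a = f b"
      by (auto simp: inj_on_def)
    let ?w = "map (id(b := a)) w"
    have "set ?w \<subset> set w" using ab by auto
    then have "card (set ?w) < card (set w)" by (intro psubset_card_mono) auto
    then have "has [] (map f ?w)" using less.hyps has_merge[OF less.prems ab(1)] by blast
    moreover have "map f ?w = map f w" using ab(4) by auto
    ultimately show ?thesis by (simp only:)
  qed
qed

text \<open>The tensor product with its disjoint letters is mapped back to the common alphabet.\<close>

lemma has_append:
  assumes "has [] xs" "has [] ys"
  shows "has [] (xs @ ys)"
proof -
  have "has [] (map Inl xs @ map Inr ys)" using has_tensor[OF assms] by simp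
  from has_map[OF this, of "case_sum id id"] show ?thesis by (simp add: o_def)
qed

lemma has_weq: "weq xs ys \<Longrightarrow> has [] xs \<longleftrightarrow> has [] ys"
proof (induction rule: weq.induct)
  case (weq_cancel xs i ys)
  show ?case using has_insert_pair[of xs ys i] has_delete_pair[of xs i ys] by (rule iffI[rotated])
qed auto

end

section \<open>Elements of the free product as words\<close>

lemma word_eq_abs: "word ls = abs_z2word ls"
  by (induction ls) (simp_all add: word_def z2_one.abs_eq gen.abs_eq z2_mult.abs_eq weq_refl)

lemma word_eq_iff: "word xs = word ys \<longleftrightarrow> weq xs ys"
  by (simp add: word_eq_abs z2word.abs_eq_iff)

lemma word_append: "word (xs @ ys) = z2_mult (word xs) (word ys)"
  by (simp add: word_eq_abs z2_mult.abs_eq weq_refl)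

lemma word_Nil: "word [] = z2_one"
  by (simp add: word_eq_abs z2_one.abs_eq)

lemma obtain_word: obtains xs where "w = word xs"
  using z2word.abs_induct[of "\<lambda>w. \<exists>xs. w = word xs" w] by (auto simp: word_eq_abs)

lemma inv_word: "inv\<^bsub>Z2inf\<^esub> (word xs) = word (rev xs)"
proof -
  have "z2_mult (word (rev xs)) (word xs) = z2_one"
    by (simp flip: word_append word_Nil add: word_eq_iff weq_rev_append)
  then show ?thesis
    using group.inv_equality[OF group_Z2inf, of "word (rev xs)" "word xs"] by simp
qed

lemma normal_Z2inf_iff:
  "H \<lhd> Z2inf \<longleftrightarrow> word [] \<in> H \<and>
     (\<forall>xs ys. word xs \<in> H \<and> word ys \<in> H \<longrightarrow> word (xs @ ys) \<in> H) \<and>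
     (\<forall>xs. word xs \<in> H \<longrightarrow> word (rev xs) \<in> H) \<and>
     (\<forall>xs ys. word xs \<in> H \<longrightarrow> word (ys @ xs @ rev ys) \<in> H)"
proof -
  have all: "(\<forall>w\<in>A. P w) \<longleftrightarrow> (\<forall>xs. word xs \<in> A \<longrightarrow> P (word xs))" for P and A :: "z2word set"
    by (metis obtain_word)
  have "subgroup H Z2inf \<longleftrightarrow> word [] \<in> H \<and>
     (\<forall>xs ys. word xs \<in> H \<and> word ys \<in> H \<longrightarrow> word (xs @ ys) \<in> H) \<and>
     (\<forall>xs. word xs \<in> H \<longrightarrow> word (rev xs) \<in> H)"
  proof -
    have "subgroup H Z2inf \<longleftrightarrow> z2_one \<in> H \<and> (\<forall>w\<in>H. \<forall>v\<in>H. z2_mult w v \<in> H) \<and>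
      (\<forall>w\<in>H. inv\<^bsub>Z2inf\<^esub> w \<in> H)"
      by (auto simp: subgroup_def)
    then show ?thesis
      unfolding all by (simp add: inv_word word_append word_Nil) blast
  qed
  moreover have "(\<forall>w\<in>carrier Z2inf. \<forall>h\<in>H. w \<otimes>\<^bsub>Z2inf\<^esub> h \<otimes>\<^bsub>Z2inf\<^esub> inv\<^bsub>Z2inf\<^esub> w \<in> H) \<longleftrightarrow>
     (\<forall>xs ys. word xs \<in> H \<longrightarrow> word (ys @ xs @ rev ys) \<in> H)"
    unfolding all by (auto simp: inv_word simp flip: word_append)
  ultimately show ?thesis
    unfolding group.normal_inv_iff[OF group_Z2inf] by blast
qed

lemma hom_word:
  assumes "\<phi> \<in> hom Z2inf Z2inf" "\<And>i. i \<in> set xs \<Longrightarrow> \<phi> (gen i) = gen (f i)"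
  shows "\<phi> (word xs) = word (map f xs)"
  using assms(2)
proof (induction xs)
  case Nil
  have "\<phi> \<one>\<^bsub>Z2inf\<^esub> = \<one>\<^bsub>Z2inf\<^esub>" by (rule hom_one[OF assms(1) group_Z2inf group_Z2inf])
  then show ?case by (simp add: word_Nil)
next
  case (Cons i xs)
  then show ?case using hom_mult[OF assms(1), of "gen i" "word xs"] by (simp add: word_def)
qed

text \<open>An endomorphism in the generating set changes finitely many generators only, but a word has
  finitely many letters; so on a given word it can realise any map of letters.\<close>

lemma sS_invariant_iff:
  "sS_invariant H \<longleftrightarrow> (\<forall>f xs. word xs \<in> H \<longrightarrow> word (map f xs) \<in> H)"
proof
  assume inv: "sS_invariant H"
  show "\<forall>f xs. word xs \<in> H \<longrightarrow> word (map f xs) \<in> H"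
  proof (intro allI impI)
    fix f xs assume xs: "word xs \<in> H"
    define n where "n = Suc (Max (insert 0 (set xs)))"
    have n: "i < n" if "i \<in> set xs" for i
      using that by (simp add: n_def less_Suc_eq_le)
    define F where "F k = gen (if k < n then f k else k)" for k
    have "z2_mult (F k) (F k) = z2_one" for k
      using weq_cancel[of "[]" "if k < n then f k else k" "[]"]
      by (simp add: F_def gen.abs_eq z2_mult.abs_eq weq_refl z2_one.abs_eq z2word.abs_eq_iff)
    then obtain \<phi> where \<phi>: "\<phi> \<in> hom Z2inf Z2inf" "\<And>k. \<phi> (gen k) = F k"
      using Z2inf_universal[OF group_Z2inf, of F] by auto
    have "\<phi> \<in> sS_inf"
      by (rule sS_inf.ident[of _ n f]) (use \<phi> in \<open>auto simp: F_def\<close>)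
    then have "\<phi> (word xs) \<in> H" using inv xs by (auto simp: sS_invariant_def)
    moreover have "\<phi> (word xs) = word (map f xs)"
      by (rule hom_word[OF \<phi>(1)]) (use n \<phi> in \<open>auto simp: F_def\<close>)
    ultimately show "word (map f xs) \<in> H" by simp
  qed
next
  assume map: "\<forall>f xs. word xs \<in> H \<longrightarrow> word (map f xs) \<in> H"
  have "\<phi> ` H \<subseteq> H" if "\<phi> \<in> sS_inf" for \<phi>
    using that
  proof induction
    case (ident \<phi> n i)
    have "\<phi> w \<in> H" if "w \<in> H" for w
    proof -
      obtain xs where xs: "w = word xs" by (rule obtain_word)
      have "\<phi> w = word (map (\<lambda>k. if k < n then i k else k) xs)"
        unfolding xs by (rule hom_word) (use ident in auto)
      then show ?thesis using map that xs by simp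
    qed
    then show ?case by blast
  qed auto
  then show "sS_invariant H" by (simp add: sS_invariant_def)
qed

section \<open>The two maps in terms of labelled rows\<close>

lemma boundary_nth:
  assumes "r < length ls + length us"
  shows "lab us [] ls (boundary (length us) (length ls) ! r) = (ls @ rev us) ! r"
  using assms by (auto simp: boundary_def nth_append rev_nth)

lemma set_boundary: "set (boundary k m) = points k m"
  by (auto simp: boundary_def points_def)

text \<open>The boundary starts with the lower row and traverses the upper row backwards, so the labels of the
  rows \<open>us\<close> and \<open>ls\<close> form the word \<open>ls @ rev us\<close>.\<close>

lemma labelling_iff:
  assumes "p \<in> partitions (length us) (length ls)"
  shows "labelling (length us) (length ls) p (ls @ rev us) \<longleftrightarrow> p = part_of us ls"
proof -
  let ?S = "points (length us) (length ls)" and ?b = "boundary (length us) (length ls)"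
  let ?n = "length us + length ls"
  have len: "length ?b = ?n" by (simp add: boundary_def)
  have all: "(\<forall>x\<in>?S. P x) \<longleftrightarrow> (\<forall>r<?n. P (?b ! r))" for P
    unfolding set_boundary[symmetric] len[symmetric] by (simp add: all_set_conv_all_nth)
  have p: "partition_on ?S p" using assms by (simp add: partitions_def)
  show ?thesis
    unfolding part_of_def partition_on_eq_fibres_iff[OF p] all labelling_def
    by (auto simp: boundary_nth add.commute)
qed

lemma obtain_rows:
  assumes "length w = k + m"
  obtains us ls where "length us = k" "length ls = m" "w = ls @ rev us"
  by (rule that[of "rev (drop m w)" "take m w"]) (use assms in auto)

lemma F_of_eq:
  assumes "\<And>k l. C k l \<subseteq> partitions k l"
  shows "F_of C = {word (ls @ rev us) | us ls. part_of us ls \<in> C (length us) (length ls)}"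
proof (intro equalityI subsetI)
  fix x assume "x \<in> F_of C"
  then obtain k m p w where *: "p \<in> C k m" "labelling k m p w" "x = word w"
    by (auto simp: F_of_def)
  then obtain us ls where "length us = k" "length ls = m" "w = ls @ rev us"
    using obtain_rows[of w k m] by (auto simp: labelling_def)
  with * show "x \<in> {word (ls @ rev us) | us ls. part_of us ls \<in> C (length us) (length ls)}"
    using labelling_iff[of p us ls] assms by blast
next
  fix x assume "x \<in> {word (ls @ rev us) | us ls. part_of us ls \<in> C (length us) (length ls)}"
  then show "x \<in> F_of C"
    unfolding F_of_def using labelling_iff[OF part_of_partition] by blast
qed

lemma C_of_eq:
  "C_of H k m = {part_of us ls | us ls. length us = k \<and> length ls = m \<and> word (ls @ rev us) \<in> H}"
proof (intro equalityI subsetI)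
  fix p assume "p \<in> C_of H k m"
  then obtain w where *: "p \<in> partitions k m" "labelling k m p w" "word w \<in> H"
    by (auto simp: C_of_def)
  then obtain us ls where "length us = k" "length ls = m" "w = ls @ rev us"
    using obtain_rows[of w k m] by (auto simp: labelling_def)
  with * show "p \<in> {part_of us ls | us ls. length us = k \<and> length ls = m \<and> word (ls @ rev us) \<in> H}"
    using labelling_iff[of p us ls] by blast
next
  fix p assume "p \<in> {part_of us ls | us ls. length us = k \<and> length ls = m \<and> word (ls @ rev us) \<in> H}"
  then show "p \<in> C_of H k m"
    unfolding C_of_def using labelling_iff[OF part_of_partition] part_of_partition by blast
qed

section \<open>From categories to subgroups\<close>

context group_theoretical
begin

lemma word_in_F_of_iff: "word xs \<in> F_of C \<longleftrightarrow> has [] xs"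
proof
  assume "word xs \<in> F_of C"
  then obtain us ls :: "nat list" where "word xs = word (ls @ rev us)" "has us ls"
    unfolding F_of_eq[OF subset_partitions] has_def by blast
  then show "has [] xs" using has_iff_word has_weq word_eq_iff by blast
next
  assume "has [] xs"
  then show "word xs \<in> F_of C"
    unfolding F_of_eq[OF subset_partitions] has_def
    by (intro CollectI exI[of _ "[] :: nat list"] exI[of _ xs] conjI) simp_all
qed

lemma F_of_normal: "F_of C \<lhd> Z2inf"
proof -
  have "has [] (ys @ xs @ rev ys)" if "has [] xs" for xs ys
  proof (induction ys)
    case (Cons i ys)
    \<comment> \<open>Append \<open>i i\<close> and rotate the last letter to the front: this conjugates by \<open>gen i\<close>.\<close>
    have "has [] ((ys @ xs @ rev ys) @ [i, i] @ [])" using Cons by (intro has_insert_pair) simp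
    then show ?case using has_cyclic[of i "(ys @ xs @ rev ys) @ [i]"] by simp
  qed (simp add: that)
  then show ?thesis
    unfolding normal_Z2inf_iff word_in_F_of_iff using has_empty has_append has_rev by blast
qed

lemma F_of_invariant: "sS_invariant (F_of C)"
  unfolding sS_invariant_iff word_in_F_of_iff using has_map by blast

lemma C_of_F_of: "C_of (F_of C) = C"
proof (intro ext equalityI subsetI)
  fix k m p assume "p \<in> C_of (F_of C) k m"
  then show "p \<in> C k m"
    unfolding C_of_eq word_in_F_of_iff using has_iff_word by (auto simp: has_def)
next
  fix k m p assume p: "p \<in> C k m"
  then have "p \<in> partitions k m" using subset_partitions by blast
  then obtain us ls :: "nat list" where "length us = k" "length ls = m" "p = part_of us ls"
    by (rule obtain_part_of)
  with p show "p \<in> C_of (F_of C) k m"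
    unfolding C_of_eq word_in_F_of_iff using has_iff_word has_def by blast
qed

end

section \<open>From subgroups to categories\<close>

locale invariant_normal_subgroup =
  fixes H :: "z2word set"
  assumes normal: "H \<lhd> Z2inf" and invariant: "sS_invariant H"
begin

lemma word_append_in: "word xs \<in> H \<Longrightarrow> word ys \<in> H \<Longrightarrow> word (xs @ ys) \<in> H"
  and word_rev_in: "word xs \<in> H \<Longrightarrow> word (rev xs) \<in> H"
  and word_conj_in: "word xs \<in> H \<Longrightarrow> word (zs @ xs @ rev zs) \<in> H"
  and word_map_in: "word xs \<in> H \<Longrightarrow> word (map f xs) \<in> H"
  and word_Nil_in: "word [] \<in> H"
  using normal invariant unfolding normal_Z2inf_iff sS_invariant_iff by blast+

lemma word_weq_in: "word xs \<in> H \<Longrightarrow> weq xs ys \<Longrightarrow> word ys \<in> H"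
  using word_eq_iff by metis

text \<open>By definition some labelling of the partition has its word in \<open>H\<close>. The labelling in question
  differs from it by a map of letters, under which \<open>H\<close> is stable.\<close>

lemma part_of_in_iff: "part_of us ls \<in> C_of H (length us) (length ls) \<longleftrightarrow> word (ls @ rev us) \<in> H"
proof
  assume "part_of us ls \<in> C_of H (length us) (length ls)"
  then obtain us' ls' where *: "length us' = length us" "length ls' = length ls"
    "part_of us ls = part_of us' ls'" "word (ls' @ rev us') \<in> H"
    unfolding C_of_eq by auto
  obtain f where "us = map f us'" "ls = map f ls'"
    using part_of_eqD[of us' ls' us ls] * by metis
  with word_map_in[OF *(4), of f] show "word (ls @ rev us) \<in> H" by (simp add: rev_map)
qed (auto simp: C_of_eq)

lemma obtain_word_of_part:
  assumes "p \<in> C_of H k l"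
  obtains us ls where "length us = k" "length ls = l" "p = part_of us ls" "word (ls @ rev us) \<in> H"
  using assms unfolding C_of_eq by blast

lemma word_cyclic: "word (x # xs) \<in> H \<longleftrightarrow> word (xs @ [x]) \<in> H"
proof
  assume "word (x # xs) \<in> H"
  from word_conj_in[OF this, of "[x]"] show "word (xs @ [x]) \<in> H"
    by (rule word_weq_in) (use weq_cancel[of "[]" x "xs @ [x]"] in simp)
next
  assume "word (xs @ [x]) \<in> H"
  from word_conj_in[OF this, of "[x]"] show "word (x # xs) \<in> H"
    by (rule word_weq_in) (use weq_cancel[of "x # xs" x "[]"] in simp)
qed

text \<open>Let \<open>L\<close> number the connected components of the three-row diagram, with rows \<open>u\<close>, \<open>m\<close>, \<open>l\<close> of labels.
  The words \<open>m u\<inverse>\<close> and \<open>l m\<inverse>\<close> arise from words of the two factors by maps of letters, hence lie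
  in \<open>H\<close>. Their product in the order \<open>l m\<inverse> m u\<inverse>\<close> is the word \<open>l u\<inverse>\<close> of the composition.\<close>

lemma composition_in:
  assumes "p \<in> C_of H k l" "q \<in> C_of H l m"
  shows "composition q p \<in> C_of H k m"
proof -
  obtain us ms where p: "length us = k" "length ms = l" "p = part_of us ms" "word (ms @ rev us) \<in> H"
    using assms(1) by (rule obtain_word_of_part)
  obtain ms' ls where q: "length ms' = l" "length ls = m" "q = part_of ms' ls" "word (ls @ rev ms') \<in> H"
    using assms(2) by (rule obtain_word_of_part)
  have len: "length ms = length ms'" using p q by simp
  define T where "T = rows k l m"
  define E where "E = (\<Union>B\<in>glue p q. B \<times> B)"
  have E_iff: "(x, y) \<in> E \<longleftrightarrow>
      x \<in> rows k l 0 \<and> y \<in> rows k l 0 \<and> lab us ms [] x = lab us ms [] y \<or>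
      x \<in> rows 0 l m \<and> y \<in> rows 0 l m \<and> lab [] ms' ls x = lab [] ms' ls y" for x y
    unfolding E_def p(3) q(3) glue_part_of[OF len] UN_Un Un_iff fibres_related_iff
    using p(1,2) q(2) by simp
  have "finite ((\<lambda>x. E\<^sup>+ `` {x}) ` T)" by (simp add: T_def)
  then obtain h :: "point set \<Rightarrow> nat" where h: "inj_on h ((\<lambda>x. E\<^sup>+ `` {x}) ` T)"
    using finite_imp_inj_to_nat_seg by metis
  define L where "L x = h (E\<^sup>+ `` {x})" for x
  have sym: "sym (E\<^sup>+)" by (rule sym_trancl) (auto simp: E_def sym_def)
  have class_eq: "E\<^sup>+ `` {x} = E\<^sup>+ `` {y}" if "(x, y) \<in> E\<^sup>+" for x y
    using that sym by (auto dest: symD intro: trancl_trans)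
  have conn: "(x, y) \<in> E\<^sup>+ \<longleftrightarrow> L x = L y" if "x \<in> T" "y \<in> T" for x y
  proof
    assume "L x = L y"
    then have "E\<^sup>+ `` {x} = E\<^sup>+ `` {y}" using h that by (auto simp: L_def inj_on_def)
    moreover have "(y, y) \<in> E" using that by (cases y) (auto simp: E_iff T_def)
    ultimately show "(x, y) \<in> E\<^sup>+" by auto
  qed (simp add: L_def class_eq)
  have E_L: "L x = L y" if "(x, y) \<in> E" for x y
    using class_eq[OF r_into_trancl[OF that]] by (simp add: L_def)
  obtain f where f: "\<And>x. x \<in> rows k l 0 \<Longrightarrow> L x = f (lab us ms [] x)"
    using labels_factor[of "rows k l 0" "lab us ms []" L] E_L E_iff by blast
  obtain g where g: "\<And>x. x \<in> rows 0 l m \<Longrightarrow> L x = g (lab [] ms' ls x)"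
    using labels_factor[of "rows 0 l m" "lab [] ms' ls" L] E_L E_iff by blast
  have mid: "map f ms = map g ms'"
  proof (rule nth_equalityI)
    fix i assume "i < length (map f ms)"
    then show "map f ms ! i = map g ms' ! i"
      using f[of "Mid i"] g[of "Mid i"] p q by simp
  qed (simp add: len)
  have "composition q p = fibres (points k m) L"
    using composition_part_of[OF len, of us ls L] conn p q
    by (simp add: connected_in_def E_def T_def)
  also have "\<dots> = part_of (map f us) (map g ls)"
    unfolding part_of_def length_map p(1) q(2)
  proof (rule fibres_cong)
    have "L x = lab (map f us) [] (map g ls) x" if "x \<in> points k m" for x
      using that f[of x] g[of x] p q by (cases x) auto
    then show "L x = L y \<longleftrightarrow> lab (map f us) [] (map g ls) x = lab (map f us) [] (map g ls) y"
      if "x \<in> points k m" "y \<in> points k m" for x y using that by simp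
  qed
  finally have comp: "composition q p = part_of (map f us) (map g ls)" .
  have "word ((map g ls @ rev (map f ms)) @ map f ms @ rev (map f us)) \<in> H"
    using word_append_in[OF word_map_in[OF q(4), of g] word_map_in[OF p(4), of f]]
    by (simp add: rev_map mid)
  then have "word (map g ls @ rev (map f us)) \<in> H"
    by (rule word_weq_in)
      (use weq_context[OF weq_rev_append, of "map g ls" "map f ms" "rev (map f us)"] in simp)
  then show ?thesis
    using part_of_in_iff[of "map f us" "map g ls"] p q comp by simp
qed

text \<open>With disjoint alphabets for the two factors, the word of the tensor product is \<open>l l' u'\<inverse> u\<inverse>\<close>, which is the
  conjugate of \<open>l' u'\<inverse>\<close> by \<open>l\<close> times \<open>l u\<inverse>\<close>.\<close>

lemma tensor_in:
  assumes "p \<in> C_of H k l" "q \<in> C_of H k' l'"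
  shows "tensor k l p q \<in> C_of H (k + k') (l + l')"
proof -
  obtain us ls where p: "length us = k" "length ls = l" "p = part_of us ls" "word (ls @ rev us) \<in> H"
    using assms(1) by (rule obtain_word_of_part)
  obtain us' ls' where q: "length us' = k'" "length ls' = l'" "q = part_of us' ls'" "word (ls' @ rev us') \<in> H"
    using assms(2) by (rule obtain_word_of_part)
  \<comment> \<open>Even and odd numbers serve as the two disjoint alphabets.\<close>
  define f g :: "nat \<Rightarrow> nat" where "f i = 2 * i" and "g i = 2 * i + 1" for i
  have "inj (case_sum f g)"
    by (auto simp: inj_on_def f_def g_def split: sum.splits) presburger+
  then have "part_of (map (case_sum f g) (map Inl us @ map Inr us'))
      (map (case_sum f g) (map Inl ls @ map Inr ls')) = tensor k l p q"
    unfolding p(3) q(3) p(1)[symmetric] p(2)[symmetric] tensor_part_of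
    by (intro part_of_map_inj) (auto intro: inj_on_subset)
  then have tensor: "tensor k l p q = part_of (map f us @ map g us') (map f ls @ map g ls')"
    by (simp add: o_def)
  have "word ((map f ls @ map g (ls' @ rev us') @ rev (map f ls)) @ map f (ls @ rev us)) \<in> H"
    by (intro word_append_in word_conj_in word_map_in p q)
  then have "word ((map f ls @ map g ls') @ rev (map f us @ map g us')) \<in> H"
    by (rule word_weq_in)
      (use weq_context[OF weq_rev_append, of "map f ls @ map g (ls' @ rev us')" "map f ls" "map f (rev us)"]
        in \<open>simp add: rev_map\<close>)
  then show ?thesis
    unfolding tensor part_of_in_iff[symmetric] using p(1,2) q(1,2) by simp
qed

lemma group_theoretical_C_of: "group_theoretical (C_of H)"
proof
  show "C_of H k l \<subseteq> partitions k l" for k l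
    by (auto simp: C_of_def)
  show "tensor k l p q \<in> C_of H (k + k') (l + l')" if "p \<in> C_of H k l" "q \<in> C_of H k' l'" for p q k l k' l'
    using that by (rule tensor_in)
  show "composition q p \<in> C_of H k m" if "p \<in> C_of H k l" "q \<in> C_of H l m" for p q k l m
    using that by (rule composition_in)
  show "involution p \<in> C_of H l k" if p_in: "p \<in> C_of H k l" for p k l
  proof -
    obtain us ls where p: "length us = k" "length ls = l" "p = part_of us ls" "word (ls @ rev us) \<in> H"
      using p_in by (rule obtain_word_of_part)
    from word_rev_in[OF p(4)] show ?thesis
      using part_of_in_iff[of ls us] p by (simp add: involution_part_of)
  qed
  show "relabel rot_left_down p \<in> C_of H k (Suc l)" if p_in: "p \<in> C_of H (Suc k) l" for p k l
  proof -
    obtain x us ls where p: "length us = k" "length ls = l" "p = part_of (x # us) ls" "word (ls @ rev (x # us)) \<in> H"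
      using obtain_word_of_part[OF p_in] by (metis length_Suc_conv)
    then show ?thesis
      using part_of_in_iff[of us "x # ls"] word_cyclic[of x "ls @ rev us"]
      by (simp add: rot_left_down_part_of)
  qed
  show "relabel rot_left_up p \<in> C_of H (Suc k) l" if p_in: "p \<in> C_of H k (Suc l)" for p k l
  proof -
    obtain x us ls where p: "length us = k" "length ls = l" "p = part_of us (x # ls)" "word ((x # ls) @ rev us) \<in> H"
      using obtain_word_of_part[OF p_in] by (metis length_Suc_conv)
    then show ?thesis
      using part_of_in_iff[of "x # us" ls] word_cyclic[of x "ls @ rev us"]
      by (simp add: rot_left_up_part_of)
  qed
  show "relabel (rot_right_down k l) p \<in> C_of H k (Suc l)" if p_in: "p \<in> C_of H (Suc k) l" for p k l
  proof -
    obtain x us ls where p: "length us = k" "length ls = l" "p = part_of (us @ [x]) ls" "word (ls @ rev (us @ [x])) \<in> H"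
      using obtain_word_of_part[OF p_in] by (metis length_Suc_conv_rev)
    then show ?thesis
      using part_of_in_iff[of us "ls @ [x]"] rot_right_down_part_of[of us ls x] by simp
  qed
  show "relabel (rot_right_up k l) p \<in> C_of H (Suc k) l" if p_in: "p \<in> C_of H k (Suc l)" for p k l
  proof -
    obtain x us ls where p: "length us = k" "length ls = l" "p = part_of us (ls @ [x])" "word ((ls @ [x]) @ rev us) \<in> H"
      using obtain_word_of_part[OF p_in] by (metis length_Suc_conv_rev)
    then show ?thesis
      using part_of_in_iff[of "us @ [x]" ls] rot_right_up_part_of[of us ls x] by simp
  qed
  have "word [0, 0] \<in> H"
    by (rule word_weq_in[OF word_Nil_in]) (use weq_cancel[of "[]" 0 "[]", THEN weq_sym] in simp)
  then show "id_part \<in> C_of H 1 1"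
    using part_of_in_iff[of "[0]" "[0]"] by (simp add: id_part_eq[of "0 :: nat"])
  \<comment> \<open>The word \<open>b a a b a a\<close> of the pair positioner is trivial in the free product.\<close>
  have "weq [1, 0, 0, 1, 0, 0] []"
    using weq_cancel[of "[1, 0, 0, 1]" 0 "[]"] weq_cancel[of "[1]" 0 "[1]"] weq_cancel[of "[]" 1 "[]"]
    by (auto intro: weq_trans)
  then have "word [1, 0, 0, 1, 0, 0] \<in> H"
    by (rule word_weq_in[OF word_Nil_in weq_sym])
  then show "pair_positioner \<in> C_of H 3 3"
    using part_of_in_iff[of "[0, 0, 1]" "[1, 0, 0]"] pair_positioner_eq[of "0 :: nat" 1]
    by (simp add: numeral_3_eq_3)
qed

lemma F_of_C_of: "F_of (C_of H) = H"
proof -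
  have "F_of (C_of H) = {word (ls @ rev us) | us ls. word (ls @ rev us) \<in> H}"
    using F_of_eq[of "C_of H"] unfolding part_of_in_iff by (auto simp: C_of_def)
  also have "\<dots> = H"
  proof (intro equalityI subsetI)
    fix w assume "w \<in> H"
    moreover obtain xs where "w = word xs" by (rule obtain_word)
    ultimately show "w \<in> {word (ls @ rev us) | us ls. word (ls @ rev us) \<in> H}"
      by (intro CollectI exI[of _ "[]"] exI[of _ xs] conjI) simp_all
  qed auto
  finally show ?thesis .
qed

end

section \<open>Order isomorphisms preserve lattice operations\<close>

abbreviation restricted_order :: "'a::order set \<Rightarrow> 'a gorder" where
  "restricted_order S \<equiv> \<lparr>carrier = S, eq = (=), le = (\<le>)\<rparr>"

lemma least_Upper_iff:
  assumes "x \<in> S" "y \<in> S"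
  shows "least (restricted_order S) z (Upper (restricted_order S) {x, y}) \<longleftrightarrow>
     z \<in> S \<and> (\<forall>u\<in>S. z \<le> u \<longleftrightarrow> x \<le> u \<and> y \<le> u)"
  using assms by (auto simp: least_def Upper_def)

lemma greatest_Lower_iff:
  assumes "x \<in> S" "y \<in> S"
  shows "greatest (restricted_order S) z (Lower (restricted_order S) {x, y}) \<longleftrightarrow>
     z \<in> S \<and> (\<forall>u\<in>S. u \<le> z \<longleftrightarrow> u \<le> x \<and> u \<le> y)"
  using assms by (auto simp: greatest_def Lower_def)

lemma join_eqI:
  assumes "x \<in> S" "y \<in> S" "z \<in> S" "\<forall>u\<in>S. z \<le> u \<longleftrightarrow> x \<le> u \<and> y \<le> u"
  shows "x \<squnion>\<^bsub>restricted_order S\<^esub> y = z"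
  unfolding join_def Lattice.sup_def least_Upper_iff[OF assms(1,2)]
  using assms(3,4) by (intro some_equality) (auto intro: order.antisym)

lemma meet_eqI:
  assumes "x \<in> S" "y \<in> S" "z \<in> S" "\<forall>u\<in>S. u \<le> z \<longleftrightarrow> u \<le> x \<and> u \<le> y"
  shows "x \<sqinter>\<^bsub>restricted_order S\<^esub> y = z"
  unfolding meet_def Lattice.inf_def greatest_Lower_iff[OF assms(1,2)]
  using assms(3,4) by (intro some_equality) (auto intro: order.antisym)

lemma lattice_restricted_order:
  assumes "\<And>x y. x \<in> S \<Longrightarrow> y \<in> S \<Longrightarrow> \<exists>z\<in>S. \<forall>u\<in>S. z \<le> u \<longleftrightarrow> x \<le> u \<and> y \<le> u"
    and "\<And>x y. x \<in> S \<Longrightarrow> y \<in> S \<Longrightarrow> \<exists>z\<in>S. \<forall>u\<in>S. u \<le> z \<longleftrightarrow> u \<le> x \<and> u \<le> y"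
  shows "lattice (restricted_order S)"
proof
  show "\<exists>s. least (restricted_order S) s (Upper (restricted_order S) {x, y})"
    if "x \<in> carrier (restricted_order S)" "y \<in> carrier (restricted_order S)" for x y
    using that assms(1) by (simp add: least_Upper_iff) blast
  show "\<exists>s. greatest (restricted_order S) s (Lower (restricted_order S) {x, y})"
    if "x \<in> carrier (restricted_order S)" "y \<in> carrier (restricted_order S)" for x y
    using that assms(2) by (simp add: greatest_Lower_iff) blast
qed auto

text \<open>The isomorphism carries bounds back to the source, so that both orders are lattices; the
  operations agree because least upper and greatest lower bounds are unique.\<close>

lemma order_iso_pres:
  fixes f :: "'a::order \<Rightarrow> 'b::order"
  assumes bij: "bij_betw f S T"
    and mono: "\<And>x y. x \<in> S \<Longrightarrow> y \<in> S \<Longrightarrow> f x \<le> f y \<longleftrightarrow> x \<le> y"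
    and sup: "\<And>x y. x \<in> T \<Longrightarrow> y \<in> T \<Longrightarrow> \<exists>z\<in>T. \<forall>u\<in>T. z \<le> u \<longleftrightarrow> x \<le> u \<and> y \<le> u"
    and inf: "\<And>x y. x \<in> T \<Longrightarrow> y \<in> T \<Longrightarrow> \<exists>z\<in>T. \<forall>u\<in>T. u \<le> z \<longleftrightarrow> u \<le> x \<and> u \<le> y"
  shows "meet_pres (restricted_order S) (restricted_order T) f"
    and "join_pres (restricted_order S) (restricted_order T) f"
proof -
  have T: "T = f ` S" using bij by (simp add: bij_betw_def)
  have sup_S: "\<exists>z\<in>S. (\<forall>u\<in>S. z \<le> u \<longleftrightarrow> x \<le> u \<and> y \<le> u) \<and>
      (\<forall>u\<in>T. f z \<le> u \<longleftrightarrow> f x \<le> u \<and> f y \<le> u)" if "x \<in> S" "y \<in> S" for x y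
    using sup[of "f x" "f y"] that mono unfolding T by auto
  have inf_S: "\<exists>z\<in>S. (\<forall>u\<in>S. u \<le> z \<longleftrightarrow> u \<le> x \<and> u \<le> y) \<and>
      (\<forall>u\<in>T. u \<le> f z \<longleftrightarrow> u \<le> f x \<and> u \<le> f y)" if "x \<in> S" "y \<in> S" for x y
    using inf[of "f x" "f y"] that mono unfolding T by auto
  have lattice: "lattice (restricted_order S)" "lattice (restricted_order T)"
    by (rule lattice_restricted_order, metis sup_S, metis inf_S)
      (rule lattice_restricted_order[OF sup inf])
  have "f (x \<squnion>\<^bsub>restricted_order S\<^esub> y) = f x \<squnion>\<^bsub>restricted_order T\<^esub> f y" if xy: "x \<in> S" "y \<in> S" for x y
  proof -
    obtain z where "z \<in> S" "\<forall>u\<in>S. z \<le> u \<longleftrightarrow> x \<le> u \<and> y \<le> u"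
      "\<forall>u\<in>T. f z \<le> u \<longleftrightarrow> f x \<le> u \<and> f y \<le> u" using sup_S[OF xy] by blast
    then show ?thesis using xy join_eqI[of x S y z] join_eqI[of "f x" T "f y" "f z"] by (simp add: T)
  qed
  moreover have "f (x \<sqinter>\<^bsub>restricted_order S\<^esub> y) = f x \<sqinter>\<^bsub>restricted_order T\<^esub> f y" if xy: "x \<in> S" "y \<in> S" for x y
  proof -
    obtain z where "z \<in> S" "\<forall>u\<in>S. u \<le> z \<longleftrightarrow> u \<le> x \<and> u \<le> y"
      "\<forall>u\<in>T. u \<le> f z \<longleftrightarrow> u \<le> f x \<and> u \<le> f y" using inf_S[OF xy] by blast
    then show ?thesis using xy meet_eqI[of x S y z] meet_eqI[of "f x" T "f y" "f z"] by (simp add: T)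
  qed
  ultimately show "meet_pres (restricted_order S) (restricted_order T) f"
    "join_pres (restricted_order S) (restricted_order T) f"
    using lattice by (simp_all add: meet_pres_def join_pres_def)
qed

section \<open>The correspondence\<close>

lemma Inter_invariant_normal:
  assumes "\<And>H. H \<in> \<H> \<Longrightarrow> H \<lhd> Z2inf \<and> sS_invariant H"
  shows "\<Inter>\<H> \<lhd> Z2inf \<and> sS_invariant (\<Inter>\<H>)"
  using assms unfolding normal_Z2inf_iff sS_invariant_iff by simp

lemma F_of_mono: "C \<le> D \<Longrightarrow> F_of C \<subseteq> F_of D"
  unfolding F_of_def le_fun_def by blast

lemma C_of_mono: "H \<subseteq> K \<Longrightarrow> C_of H \<le> C_of K"
  unfolding C_of_def le_fun_def by blast

theorem theorem3p7:
  shows "(\<forall>C. group_theoretical C \<longrightarrow>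
            F_of C \<lhd> Z2inf \<and> sS_invariant (F_of C) \<and> C_of (F_of C) = C) \<and>
         (\<forall>H. H \<lhd> Z2inf \<and> sS_invariant H \<longrightarrow>
            group_theoretical (C_of H) \<and> F_of (C_of H) = H) \<and>
         bij_betw F_of (carrier gt_categories) (carrier invariant_normal_subgroups) \<and>
         meet_pres gt_categories invariant_normal_subgroups F_of \<and>
         join_pres gt_categories invariant_normal_subgroups F_of"
proof -
  let ?S = "{C. group_theoretical C}" and ?T = "{H. H \<lhd> Z2inf \<and> sS_invariant H}"
  have F: "F_of C \<lhd> Z2inf \<and> sS_invariant (F_of C) \<and> C_of (F_of C) = C" if "group_theoretical C" for C
  proof -
    interpret group_theoretical C by fact
    show ?thesis using F_of_normal F_of_invariant C_of_F_of by blast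
  qed
  have C: "group_theoretical (C_of H) \<and> F_of (C_of H) = H" if "H \<lhd> Z2inf" "sS_invariant H" for H
  proof -
    interpret invariant_normal_subgroup H
      using that by (rule invariant_normal_subgroup.intro)
    show ?thesis using group_theoretical_C_of F_of_C_of by blast
  qed
  have bij: "bij_betw F_of ?S ?T"
    by (rule bij_betwI[where g = C_of]) (use F C in auto)
  have mono: "F_of C \<le> F_of D \<longleftrightarrow> C \<le> D" if "C \<in> ?S" "D \<in> ?S" for C D
    using that F F_of_mono C_of_mono by (metis mem_Collect_eq)
  \<comment> \<open>The join is the intersection of all upper bounds.\<close>
  have sup: "\<exists>L\<in>?T. \<forall>U\<in>?T. L \<le> U \<longleftrightarrow> H \<le> U \<and> K \<le> U" if "H \<in> ?T" "K \<in> ?T" for H K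
    by (rule bexI[of _ "\<Inter>{U \<in> ?T. H \<le> U \<and> K \<le> U}"]) (use Inter_invariant_normal[of "{U \<in> ?T. H \<le> U \<and> K \<le> U}"] in auto)
  have inf: "\<exists>L\<in>?T. \<forall>U\<in>?T. U \<le> L \<longleftrightarrow> U \<le> H \<and> U \<le> K" if "H \<in> ?T" "K \<in> ?T" for H K
    by (rule bexI[of _ "\<Inter>{H, K}"]) (use that Inter_invariant_normal[of "{H, K}"] in auto)
  show ?thesis
    using F C bij order_iso_pres[OF bij mono sup inf]
    by (simp add: gt_categories_def invariant_normal_subgroups_def)
qed

end
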